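(* Let $G=(V,E)$ be a graph with a nearest neighbour random walk whose transition operator $T$ on $\ell_2(G)$ is selfadjoint, let $m\ge 2$ be the number of lamp states, let $\widetilde T$ be the transition operator of the associated switch-walk-switch lamplighter random walk on $\mathcal{H}=\ell_2(\mathfrak{C}\times G)$, and suppose that $1/m<p_c$ (subcritical regime). Then there exists a complete orthonormal system of $\mathcal{H}$ consisting of finitely supported eigenfunctions of $\widetilde T$.
   Context: Graphs are simple (no loops); $G$ is identified with its vertex set $V$, and $x\sim y$ denotes adjacency. A nearest neighbour random walk on $G$ is a Markov chain on $V$ with transition probabilities $p(x,y)\ge 0$, where $p(x,y)=0$ unless $y\sim x$, and $\sum_y p(x,y)=1$. Its transition operator on $\ell_2(G)=\{f:V\to\mathbf{C}:\sum_x|f(x)|^2<\infty\}$ is $Tf(x)=\sum_{y\sim x}p(x,y)f(y)$; it is assumed throughout to be selfadjoint (i.e. $p(x,y)=p(y,x)$). Lamplighter random walk: let $H$ be a finite set of $m=|H|$ lamp states, one of which is called "off". A configuration is a function $\eta:G\to H$ equal to "off" outside a finite set; $\mathfrak{C}=H^{(G)}$ is the set of configurations. The switch-walk-switch lamplighter random walk is the Markov chain on $\mathfrak{C}\times G$ with transition probabilities $\tilde p(\xi,x;\eta,y)=p(x,y)/m^2$ if $y\sim x$ and $\xi,\eta$ coincide outside $\{x,y\}$, and $\tilde p(\xi,x;\eta,y)=0$ otherwise. Its transition operator on $\mathcal{H}$ is $\widetilde Tf(\xi,x)=\sum_{(\eta,y)}\tilde p(\xi,x;\eta,y)f(\eta,y)$.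 Critical parameter: in Bernoulli site percolation on $G$ with parameter $p$ each vertex is independently open with probability $p$, and $C_x$ is the connected component containing $x$ of the subgraph induced on the open vertices (empty if $x$ is not open). $p_c$ is the critical parameter: the supremum of those $p\in[0,1]$ for which $C_x$ is almost surely finite for every vertex $x$. A function in $\ell_2(\mathfrak{C}\times G)$ is finitely supported if it vanishes outside a finite subset of $\mathfrak{C}\times G$. *)

theory Defs
  imports "HOL-Probability.Probability"
begin

text \<open>The elements of \<open>ell2 S\<close> are extended by zero outside \<open>S\<close>, so that equality of
  functions is equality in the Hilbert space. The parameter \<open>S\<close> is needed because the
  state space of the lamplighter walk is a proper subset of its type.\<close>

definition ell2 :: "'a set \<Rightarrow> ('a \<Rightarrow> complex) set" where
  "ell2 S = {f. (\<forall>s. s \<notin> S \<longrightarrow> f s = 0) \<and> (\<lambda>s. (cmod (f s))\<^sup>2) summable_on S}"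

definition ell2_inner :: "'a set \<Rightarrow> ('a \<Rightarrow> complex) \<Rightarrow> ('a \<Rightarrow> complex) \<Rightarrow> complex" where
  "ell2_inner S f g = (\<Sum>\<^sub>\<infinity>s\<in>S. f s * cnj (g s))"

definition ell2_norm :: "'a set \<Rightarrow> ('a \<Rightarrow> complex) \<Rightarrow> real" where
  "ell2_norm S f = sqrt (\<Sum>\<^sub>\<infinity>s\<in>S. (cmod (f s))\<^sup>2)"

definition orthonormal_system :: "'a set \<Rightarrow> ('a \<Rightarrow> complex) set \<Rightarrow> bool" where
  "orthonormal_system S B \<longleftrightarrow>
     B \<subseteq> ell2 S \<and> (\<forall>b\<in>B. \<forall>b'\<in>B. ell2_inner S b b' = (if b = b' then 1 else 0))"

text \<open>Completeness: the linear span is dense in \<open>ell2 S\<close>.\<close>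

definition complete_orthonormal_system :: "'a set \<Rightarrow> ('a \<Rightarrow> complex) set \<Rightarrow> bool" where
  "complete_orthonormal_system S B \<longleftrightarrow>
     orthonormal_system S B \<and>
     (\<forall>f\<in>ell2 S. \<forall>e>0. \<exists>F c. finite F \<and> F \<subseteq> B \<and>
        ell2_norm S (\<lambda>s. f s - (\<Sum>b\<in>F. c b * b s)) < e)"

text \<open>Applied below only to transition operators, which are linear.
  For an everywhere defined linear operator, symmetry is the same as being bounded and
  selfadjoint (Hellinger--Toeplitz).\<close>

definition selfadjoint_on_ell2 ::
    "'a set \<Rightarrow> (('a \<Rightarrow> complex) \<Rightarrow> 'a \<Rightarrow> complex) \<Rightarrow> bool" where
  "selfadjoint_on_ell2 S A \<longleftrightarrow>
     (\<forall>f\<in>ell2 S. A f \<in> ell2 S) \<and>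
     (\<forall>f\<in>ell2 S. \<forall>g\<in>ell2 S. ell2_inner S (A f) g = ell2_inner S f (A g))"

definition eigenfunction_on_ell2 ::
    "'a set \<Rightarrow> (('a \<Rightarrow> complex) \<Rightarrow> 'a \<Rightarrow> complex) \<Rightarrow> ('a \<Rightarrow> complex) \<Rightarrow> bool" where
  "eigenfunction_on_ell2 S A f \<longleftrightarrow>
     f \<in> ell2 S \<and> f \<noteq> (\<lambda>_. 0) \<and> (\<exists>c. A f = (\<lambda>s. c * f s))"

definition finitely_supported :: "('a \<Rightarrow> complex) \<Rightarrow> bool" where
  "finitely_supported f \<longleftrightarrow> finite {s. f s \<noteq> 0}"

definition transition_op ::
    "'a set \<Rightarrow> ('a \<Rightarrow> 'a \<Rightarrow> real) \<Rightarrow> ('a \<Rightarrow> complex) \<Rightarrow> 'a \<Rightarrow> complex" where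
  "transition_op S p f s =
     (if s \<in> S then \<Sum>\<^sub>\<infinity>t\<in>S. complex_of_real (p s t) * f t else 0)"

text \<open>A graph is given by its adjacency relation; its vertices are all elements of the type.
  No connectedness, local finiteness or countability is imposed.\<close>

definition simple_graph :: "('v \<Rightarrow> 'v \<Rightarrow> bool) \<Rightarrow> bool" where
  "simple_graph E \<longleftrightarrow> symp E \<and> irreflp E"

definition nearest_neighbour_walk ::
    "('v \<Rightarrow> 'v \<Rightarrow> bool) \<Rightarrow> ('v \<Rightarrow> 'v \<Rightarrow> real) \<Rightarrow> bool" where
  "nearest_neighbour_walk E p \<longleftrightarrow>
     (\<forall>x y. 0 \<le> p x y) \<and>
     (\<forall>x y. \<not> E x y \<longrightarrow> p x y = 0) \<and>
     (\<forall>x. (p x has_sum 1) UNIV)"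

definition configs :: "'h \<Rightarrow> ('v \<Rightarrow> 'h) set" where
  "configs off = {\<eta>. finite {x. \<eta> x \<noteq> off}}"

definition lamp_states :: "'h \<Rightarrow> (('v \<Rightarrow> 'h) \<times> 'v) set" where
  "lamp_states off = configs off \<times> UNIV"

definition sws_prob ::
    "('v \<Rightarrow> 'v \<Rightarrow> bool) \<Rightarrow> ('v \<Rightarrow> 'v \<Rightarrow> real) \<Rightarrow>
     ('v \<Rightarrow> 'h::finite) \<times> 'v \<Rightarrow> ('v \<Rightarrow> 'h) \<times> 'v \<Rightarrow> real" where
  "sws_prob E p = (\<lambda>(\<xi>, x) (\<eta>, y).
     if E x y \<and> (\<forall>z. z \<notin> {x, y} \<longrightarrow> \<xi> z = \<eta> z)
     then p x y / (real CARD('h))\<^sup>2 else 0)"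

definition lamplighter_op ::
    "('v \<Rightarrow> 'v \<Rightarrow> bool) \<Rightarrow> ('v \<Rightarrow> 'v \<Rightarrow> real) \<Rightarrow> 'h::finite \<Rightarrow>
     (('v \<Rightarrow> 'h) \<times> 'v \<Rightarrow> complex) \<Rightarrow> ('v \<Rightarrow> 'h) \<times> 'v \<Rightarrow> complex" where
  "lamplighter_op E p off = transition_op (lamp_states off) (sws_prob E p)"

definition site_percolation :: "real \<Rightarrow> ('v \<Rightarrow> bool) measure" where
  "site_percolation q = (\<Pi>\<^sub>M x\<in>UNIV. measure_pmf (bernoulli_pmf q))"

definition open_cluster :: "('v \<Rightarrow> 'v \<Rightarrow> bool) \<Rightarrow> ('v \<Rightarrow> bool) \<Rightarrow> 'v \<Rightarrow> 'v set" where
  "open_cluster E \<omega> x = {y. \<omega> x \<and> (\<lambda>u v. E u v \<and> \<omega> u \<and> \<omega> v)\<^sup>*\<^sup>* x y}"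

definition critical_parameter :: "('v \<Rightarrow> 'v \<Rightarrow> bool) \<Rightarrow> real" where
  "critical_parameter E =
     Sup {q. 0 \<le> q \<and> q \<le> 1 \<and>
             (\<forall>x. AE \<omega> in site_percolation q. finite (open_cluster E \<omega> x))}"

end

theory Submission
  imports Defs "Jordan_Normal_Form.Spectral_Radius"
begin

text \<open>Averaging over the lamp at \<open>z\<close> is a projection, and the projections of different vertices
  commute. Calling \<open>z\<close> open on the range and closed on the kernel of its projection turns the
  lamplighter operator into the walk killed outside a percolation cluster: for a finite connected
  set \<open>C\<close>, the functions with walker in \<open>C\<close>, all lamps of \<open>C\<close> open, all lamps of the boundary
  closed and the remaining lamps frozen form a finite-dimensional invariant space of finitely
  supported functions. For different \<open>C\<close> these spaces are orthogonal, and so they are to the kernel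
  functions with walker at a closed vertex. By the reproducing kernel, the squared length of the
  projection of \<open>\<delta>\<^bsub>(\<xi>,x)\<^esub>\<close> onto the sector of \<open>C \<ni> x\<close> is \<open>m\<^bsup>-|C|\<^esup> (1 - 1/m)\<^bsup>|\<partial>C|\<^esup>\<close>, the
  probability that \<open>C\<close> is the open cluster of \<open>x\<close> at parameter \<open>1/m\<close>. Below \<open>p\<^sub>c\<close> these numbers sum
  to \<open>1/m\<close>, the closed vertex contributes \<open>1 - 1/m\<close>, and Parseval's equality gives completeness.
  Finite clusters at a positive parameter force the graph to be locally finite.\<close>

subsection \<open>Spectral theorem in finite dimension\<close>

text \<open>The parameter 1/m is the normalised rank of one averaging projection: its range, the
  constants, is one-dimensional among the functions of a lamp with m states. The walk averages
  before and after each step, at the vertex left and at the vertex reached, so a closed vertex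
  cannot be crossed. Lamps beyond a cluster and its boundary are never touched while the walker
  stays in the cluster; freezing them pointwise keeps every sector finite-dimensional. Clusters with
  a common vertex are separated by a vertex that is open for one and closed for the other; clusters
  without one have disjoint walker positions. The obstacle is completeness, as no dimension count is
  available on the whole space. Probability enters only there: if infinite clusters had positive
  probability at 1/m, part of the mass of some point mass would be missing. Point masses are enough,
  since their closed span is everything. Selfadjointness of T enters as symmetry of p, which makes
  each finite block hermitian. The hypothesis gives finite clusters at some q > 1/m, and a monotone
  coupling descends from q to 1/m.\<close>

definition fun_subspace :: "('a \<Rightarrow> complex) set \<Rightarrow> bool" where
  "fun_subspace U \<longleftrightarrow> (\<lambda>_. 0) \<in> U \<and> (\<forall>f\<in>U. \<forall>g\<in>U. \<forall>c. (\<lambda>s. f s + c * g s) \<in> U)"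

lemma fun_subspace_add: "fun_subspace U \<Longrightarrow> f \<in> U \<Longrightarrow> g \<in> U \<Longrightarrow> (\<lambda>s. f s + c * g s) \<in> U"
  by (auto simp: fun_subspace_def)

lemma fun_subspace_sum:
  assumes "fun_subspace U" "finite B" "\<And>b. b \<in> B \<Longrightarrow> v b \<in> U"
  shows "(\<lambda>s. \<Sum>b\<in>B. c b * v b s) \<in> U"
  using assms(2,3)
proof (induction B rule: finite_induct)
  case empty
  then show ?case using assms(1) by (simp add: fun_subspace_def)
next
  case (insert b B)
  have "(\<lambda>s. (\<Sum>b\<in>B. c b * v b s) + c b * v b s) \<in> U"
    using insert by (intro fun_subspace_add[OF assms(1)]) auto
  then show ?case using insert by (simp add: add.commute)
qed

lemma fun_subspace_diff: "fun_subspace U \<Longrightarrow> f \<in> U \<Longrightarrow> g \<in> U \<Longrightarrow> (\<lambda>s. f s - g s) \<in> U"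
  using fun_subspace_add[of U f g "-1"] by simp

context
  fixes X :: "'a set"
  assumes fin: "finite X"
begin

lemma ell2_inner_fin: "ell2_inner X f g = (\<Sum>s\<in>X. f s * cnj (g s))"
  by (simp add: ell2_inner_def fin)

lemma ell2_inner_commute: "ell2_inner X g f = cnj (ell2_inner X f g)"
  by (simp add: ell2_inner_fin mult.commute)

lemma ell2_inner_sum_left:
  "ell2_inner X (\<lambda>s. \<Sum>b\<in>B. c b * v b s) g = (\<Sum>b\<in>B. c b * ell2_inner X (v b) g)"
  unfolding ell2_inner_fin
  by (simp add: sum_distrib_left sum_distrib_right mult.assoc) (rule sum.swap)

lemma ell2_inner_sum_right:
  "ell2_inner X g (\<lambda>s. \<Sum>b\<in>B. c b * v b s) = (\<Sum>b\<in>B. cnj (c b) * ell2_inner X g (v b))"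
  by (subst ell2_inner_commute, subst ell2_inner_sum_left) (simp add: ell2_inner_commute[of g])

lemma ell2_inner_add_left:
  "ell2_inner X (\<lambda>s. f s + c * g s) h = ell2_inner X f h + c * ell2_inner X g h"
  unfolding ell2_inner_fin by (simp add: sum.distrib sum_distrib_left algebra_simps)

lemma ell2_inner_diff_left:
  "ell2_inner X (\<lambda>s. f s - g s) h = ell2_inner X f h - ell2_inner X g h"
  unfolding ell2_inner_fin by (simp add: sum_subtractf algebra_simps)

lemma ell2_inner_self: "ell2_inner X f f = of_real (\<Sum>s\<in>X. (cmod (f s))\<^sup>2)"
  unfolding ell2_inner_fin of_real_sum by (intro sum.cong refl) (rule complex_norm_square[symmetric])

definition fin_orthonormal :: "('a \<Rightarrow> complex) set \<Rightarrow> bool" where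
  "fin_orthonormal B \<longleftrightarrow> (\<forall>b\<in>B. \<forall>b'\<in>B. ell2_inner X b b' = (if b = b' then 1 else 0))"

lemma ell2_inner_expansion:
  assumes "finite B" "fin_orthonormal B" "b \<in> B"
  shows "ell2_inner X (\<lambda>s. \<Sum>b'\<in>B. c b' * b' s) b = c b"
proof -
  have "ell2_inner X (\<lambda>s. \<Sum>b'\<in>B. c b' * b' s) b = (\<Sum>b'\<in>B. if b' = b then c b else 0)"
    unfolding ell2_inner_sum_left
    using assms(2,3) by (intro sum.cong) (auto simp: fin_orthonormal_def)
  then show ?thesis using assms(1,3) by simp
qed

text \<open>The residual of \<open>g\<close> is orthogonal to every \<open>b\<close> in
  \<open>B\<close>, hence to the expansion itself, so Pythagoras applies.\<close>

lemma Bessel_identity: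
  assumes B: "finite B" "fin_orthonormal B"
  shows "(\<Sum>s\<in>X. (cmod (g s - (\<Sum>b\<in>B. ell2_inner X g b * b s)))\<^sup>2)
    = (\<Sum>s\<in>X. (cmod (g s))\<^sup>2) - (\<Sum>b\<in>B. (cmod (ell2_inner X g b))\<^sup>2)"
proof -
  define h where "h = (\<lambda>s. \<Sum>b\<in>B. ell2_inner X g b * b s)"
  have hb: "ell2_inner X h b = ell2_inner X g b" if "b \<in> B" for b
    unfolding h_def by (rule ell2_inner_expansion[OF B that])
  have h0: "ell2_inner X (\<lambda>s. g s - h s) h = 0"
  proof -
    have "ell2_inner X (\<lambda>s. g s - h s) h = (\<Sum>b\<in>B. cnj (ell2_inner X g b) * ell2_inner X (\<lambda>s. g s - h s) b)"
      using ell2_inner_sum_right[of "\<lambda>s. g s - h s" "ell2_inner X g" "\<lambda>b. b" B] unfolding h_def .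
    also have "\<dots> = 0" by (intro sum.neutral ballI) (simp add: ell2_inner_diff_left hb)
    finally show ?thesis .
  qed
  have "ell2_inner X (\<lambda>s. g s - h s) (\<lambda>s. g s - h s) = ell2_inner X (\<lambda>s. g s - h s) g - ell2_inner X (\<lambda>s. g s - h s) h"
    unfolding ell2_inner_fin by (simp add: sum_subtractf algebra_simps)
  also have "\<dots> = ell2_inner X g g - ell2_inner X h g"
    unfolding h0 by (simp add: ell2_inner_diff_left)
  also have "ell2_inner X h g = (\<Sum>b\<in>B. of_real ((cmod (ell2_inner X g b))\<^sup>2))"
    unfolding h_def ell2_inner_sum_left
    by (intro sum.cong refl, subst ell2_inner_commute) (rule complex_norm_square[symmetric])
  finally have "complex_of_real (\<Sum>s\<in>X. (cmod (g s - h s))\<^sup>2) =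
     of_real ((\<Sum>s\<in>X. (cmod (g s))\<^sup>2) - (\<Sum>b\<in>B. (cmod (ell2_inner X g b))\<^sup>2))"
    unfolding ell2_inner_self by simp
  then show ?thesis unfolding h_def using of_real_eq_iff by blast
qed

lemma ell2_inner_delta: "s \<in> X \<Longrightarrow> ell2_inner X (\<lambda>t. of_bool (t = s)) b = cnj (b s)"
proof -
  assume s: "s \<in> X"
  have "ell2_inner X (\<lambda>t. of_bool (t = s)) b = (\<Sum>t\<in>X. if t = s then cnj (b t) else 0)"
    unfolding ell2_inner_fin by (intro sum.cong) auto
  then show ?thesis using s fin by simp
qed

text \<open>Double counting of \<open>(cmod (b s))\<^sup>2\<close>: each \<open>b\<close>
  contributes 1 by normalisation, each point \<open>s\<close> at most 1 by Bessel's inequality for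
  its point mass. This bound stands in for a dimension argument.\<close>

lemma fin_orthonormal_card:
  assumes B: "finite B" "fin_orthonormal B"
  shows "card B \<le> card X"
proof -
  have 1: "(\<Sum>b\<in>B. (cmod (b s))\<^sup>2) \<le> 1" if s: "s \<in> X" for s
  proof -
    have "0 \<le> (\<Sum>t\<in>X. (cmod (of_bool (t = s)))\<^sup>2) - (\<Sum>b\<in>B. (cmod (ell2_inner X (\<lambda>t. of_bool (t = s)) b))\<^sup>2)"
      unfolding Bessel_identity[OF B, symmetric] by (intro sum_nonneg) auto
    also have "(\<Sum>t\<in>X. (cmod (of_bool (t = s)))\<^sup>2) = (\<Sum>t\<in>X. if t = s then 1 else 0)"
      by (intro sum.cong) auto
    also have "\<dots> = 1" using s fin by simp
    finally show ?thesis using s by (simp add: ell2_inner_delta)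
  qed
  have "real (card B) = (\<Sum>b\<in>B. \<Sum>s\<in>X. (cmod (b s))\<^sup>2)"
  proof -
    have "(\<Sum>s\<in>X. (cmod (b s))\<^sup>2) = 1" if "b \<in> B" for b
      using B(2) that ell2_inner_self[of b] unfolding fin_orthonormal_def
      by (metis of_real_eq_1_iff)
    then show ?thesis by simp
  qed
  also have "\<dots> = (\<Sum>s\<in>X. \<Sum>b\<in>B. (cmod (b s))\<^sup>2)" by (rule sum.swap)
  also have "\<dots> \<le> (\<Sum>s\<in>X. 1)" by (intro sum_mono 1)
  finally show ?thesis by simp
qed

lemma ell2_inner_self_eq_0:
  assumes "ell2_inner X f f = 0" "\<And>s. s \<notin> X \<Longrightarrow> f s = 0"
  shows "f = (\<lambda>_. 0)"
proof
  fix s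
  have "(\<Sum>s\<in>X. (cmod (f s))\<^sup>2) = 0"
    using assms(1) unfolding ell2_inner_self by (metis of_real_eq_0_iff)
  then have "s \<in> X \<Longrightarrow> f s = 0"
    using fin by (subst (asm) sum_nonneg_eq_0_iff) auto
  then show "f s = 0" using assms(2) by blast
qed

text \<open>\<open>P\<close> lets one maximality argument serve twice: the trivial property produces
  orthonormal bases, the property of consisting of eigenvectors produces eigenbases.\<close>

lemma maximal_orthonormal:
  assumes "P {}"
  obtains B where "finite B" "B \<subseteq> U" "fin_orthonormal B" "P B"
    "\<And>B'. finite B' \<Longrightarrow> B' \<subseteq> U \<Longrightarrow> fin_orthonormal B' \<Longrightarrow> P B' \<Longrightarrow> card B' \<le> card B"
proof -
  let ?Q = "\<lambda>B. finite B \<and> B \<subseteq> U \<and> fin_orthonormal B \<and> P B"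
  have "?Q {}" using assms by (simp add: fin_orthonormal_def)
  moreover have "\<forall>B. ?Q B \<longrightarrow> card B < Suc (card X)"
    using fin_orthonormal_card by (auto simp: less_Suc_eq_le)
  ultimately have "\<exists>B. ?Q B \<and> (\<forall>B'. ?Q B' \<longrightarrow> card B' \<le> card B)"
    by (rule ex_has_greatest_nat)
  then show ?thesis using that by blast
qed

text \<open>This is what contradicts maximality below. The rescaled \<open>f\<close> is new because
  its inner product is 1 with itself and 0 with every element of \<open>B\<close>.\<close>

lemma orthonormal_extend:
  assumes U: "fun_subspace U" "U \<subseteq> {f. \<forall>s. s \<notin> X \<longrightarrow> f s = 0}"
    and B: "finite B" "B \<subseteq> U" "fin_orthonormal B"
    and f: "f \<in> U" "f \<noteq> (\<lambda>_. 0)" "\<forall>b\<in>B. ell2_inner X f b = 0"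
  obtains c where "(\<lambda>s. c * f s) \<in> U" "(\<lambda>s. c * f s) \<notin> B" "fin_orthonormal (insert (\<lambda>s. c * f s) B)"
proof -
  let ?n = "\<Sum>s\<in>X. (cmod (f s))\<^sup>2"
  have "ell2_inner X f f \<noteq> 0"
    using ell2_inner_self_eq_0[of f] f(1,2) U(2) by auto
  then have "?n \<noteq> 0" unfolding ell2_inner_self by (metis of_real_0)
  moreover have "?n \<ge> 0" by (intro sum_nonneg) auto
  ultimately have n: "?n > 0" by linarith
  define c where "c = complex_of_real (1 / sqrt ?n)"
  have U1: "(\<lambda>s. c * f s) \<in> U"
    using fun_subspace_add[OF U(1) _ f(1), of "\<lambda>_. 0" c] U(1) by (simp add: fun_subspace_def)
  have l: "ell2_inner X (\<lambda>s. c * f s) b = c * ell2_inner X f b" for b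
    unfolding ell2_inner_fin by (simp add: sum_distrib_left mult.assoc)
  have r: "ell2_inner X b (\<lambda>s. c * f s) = cnj c * ell2_inner X b f" for b
    unfolding ell2_inner_fin by (simp add: sum_distrib_left algebra_simps)
  have "c * cnj c * of_real ?n = 1"
    using n unfolding c_def by (simp flip: of_real_mult of_real_sum)
  then have one: "ell2_inner X (\<lambda>s. c * f s) (\<lambda>s. c * f s) = 1"
    unfolding l r ell2_inner_self by (simp add: mult.assoc)
  have z: "ell2_inner X (\<lambda>s. c * f s) b = 0" "ell2_inner X b (\<lambda>s. c * f s) = 0" if "b \<in> B" for b
    using f(3) that by (simp_all add: l r ell2_inner_commute[of b f])
  have nB: "(\<lambda>s. c * f s) \<notin> B" using z(1) one by fastforce
  have "fin_orthonormal (insert (\<lambda>s. c * f s) B)"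
    using B(3) one z nB unfolding fin_orthonormal_def by auto
  then show ?thesis using that U1 nB by blast
qed

text \<open>Take a maximal orthonormal subset of \<open>U\<close>. The residual of any
  \<open>f\<close> in \<open>U\<close> is orthogonal to it, and a nonzero residual could be
  normalised and added.\<close>

lemma orthonormal_basis_exists:
  assumes U: "fun_subspace U" "U \<subseteq> {f. \<forall>s. s \<notin> X \<longrightarrow> f s = 0}"
  obtains B where "finite B" "B \<subseteq> U" "fin_orthonormal B"
    "\<And>f. f \<in> U \<Longrightarrow> f = (\<lambda>s. \<Sum>b\<in>B. ell2_inner X f b * b s)"
proof -
  obtain B where B: "finite B" "B \<subseteq> U" "fin_orthonormal B"
    "\<And>B'. finite B' \<Longrightarrow> B' \<subseteq> U \<Longrightarrow> fin_orthonormal B' \<Longrightarrow> card B' \<le> card B"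
    using maximal_orthonormal[of "\<lambda>_. True" U] by auto
  have "f = (\<lambda>s. \<Sum>b\<in>B. ell2_inner X f b * b s)" if f: "f \<in> U" for f
  proof -
    define g where "g = (\<lambda>s. f s - (\<Sum>b\<in>B. ell2_inner X f b * b s))"
    have g: "g \<in> U" unfolding g_def using B f
      by (intro fun_subspace_diff fun_subspace_sum U) auto
    have gb: "\<forall>b\<in>B. ell2_inner X g b = 0"
      unfolding g_def by (simp add: ell2_inner_diff_left ell2_inner_expansion[OF B(1,3)])
    have "g = (\<lambda>_. 0)"
    proof (rule ccontr)
      assume "g \<noteq> (\<lambda>_. 0)"
      from orthonormal_extend[of U, OF U B(1-3) g this gb] obtain c where
        c: "(\<lambda>s. c * g s) \<in> U" "(\<lambda>s. c * g s) \<notin> B" "fin_orthonormal (insert (\<lambda>s. c * g s) B)" by blast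
      have "card (insert (\<lambda>s. c * g s) B) \<le> card B"
        using B c by (intro B(4)) auto
      then show False using c(2) B(1) by simp
    qed
    then show ?thesis unfolding g_def by (metis (no_types, lifting) eq_iff_diff_eq_0)
  qed
  with B that show ?thesis by blast
qed

text \<open>The matrix of \<open>T\<close> in an orthonormal basis has a complex eigenvalue, and an
  eigenvector of the matrix is the coordinate vector of one of \<open>T\<close>. The nonzero
  \<open>f\<close> makes the matrix nonempty.\<close>

lemma eigenvector_exists:
  assumes U: "fun_subspace U" "U \<subseteq> {f. \<forall>s. s \<notin> X \<longrightarrow> f s = 0}"
    and T: "\<And>f. f \<in> U \<Longrightarrow> T f \<in> U"
    and lin: "\<And>B c. finite B \<Longrightarrow> B \<subseteq> U \<Longrightarrow> T (\<lambda>s. \<Sum>b\<in>B. c b * b s) = (\<lambda>s. \<Sum>b\<in>B. c b * T b s)"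
    and f: "f \<in> U" "f \<noteq> (\<lambda>_. 0)"
  obtains g k where "g \<in> U" "g \<noteq> (\<lambda>_. 0)" "T g = (\<lambda>s. k * g s)"
proof -
  obtain B where B: "finite B" "B \<subseteq> U" "fin_orthonormal B"
    "\<And>f. f \<in> U \<Longrightarrow> f = (\<lambda>s. \<Sum>b\<in>B. ell2_inner X f b * b s)"
    using orthonormal_basis_exists[of U, OF U] by blast
  have Bne: "B \<noteq> {}" using f B(4)[OF f(1)] by auto
  define n where "n = card B"
  have n: "n > 0" using Bne B(1) by (simp add: n_def card_gt_0_iff)
  obtain e where e: "bij_betw e {0..<n} B"
    using ex_bij_betw_nat_finite[OF B(1)] n_def by blast
  \<comment> \<open>Column \<open>j\<close> holds the coordinates of \<open>T (e j)\<close> in the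
    basis \<open>e\<close>.\<close>
  define M where "M = mat n n (\<lambda>(i,j). ell2_inner X (T (e j)) (e i))"
  have M: "M \<in> carrier_mat n n" by (simp add: M_def)
  obtain k where "eigenvalue M k" using spectrum_non_empty[OF M n] by (auto simp: spectrum_def)
  then obtain v where v: "v \<in> carrier_vec n" "v \<noteq> 0\<^sub>v n" "M *\<^sub>v v = k \<cdot>\<^sub>v v"
    using M by (auto simp: eigenvalue_def eigenvector_def)
  have ev: "(\<Sum>j<n. ell2_inner X (T (e j)) (e i) * vec_index v j) = k * vec_index v i" if "i < n" for i
  proof -
    have "vec_index (M *\<^sub>v v) i = k * vec_index v i" using v that by simp
    then show ?thesis using that v(1) M
      by (simp add: M_def scalar_prod_def atLeast0LessThan)
  qed
  define c where "c b = vec_index v (the_inv_into {0..<n} e b)" for b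
  have ce: "c (e j) = vec_index v j" if "j < n" for j
    using e that by (simp add: c_def bij_betw_def the_inv_into_f_f)
  have sumB: "(\<Sum>b\<in>B. F b) = (\<Sum>j<n. F (e j))" for F :: "_ \<Rightarrow> complex"
    using sum.reindex_bij_betw[OF e, of F] by (simp add: atLeast0LessThan)
  have eB: "e i \<in> B" if "i < n" for i using e that by (auto simp: bij_betw_def)
  define g where "g = (\<lambda>s. \<Sum>b\<in>B. c b * b s)"
  have gU: "g \<in> U" unfolding g_def using B by (intro fun_subspace_sum U) auto
  have gb: "ell2_inner X g b = c b" if "b \<in> B" for b
    unfolding g_def by (rule ell2_inner_expansion[OF B(1,3) that])
  have Tg: "T g = (\<lambda>s. \<Sum>b\<in>B. c b * T b s)" unfolding g_def by (rule lin[OF B(1,2)])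
  have Tgb: "ell2_inner X (T g) b = k * c b" if b: "b \<in> B" for b
  proof -
    obtain i where i: "i < n" "b = e i" using e b by (auto simp: bij_betw_def)
    show ?thesis unfolding Tg ell2_inner_sum_left sumB i(2)
      using ev[OF i(1)] i(1) by (simp add: ce mult.commute)
  qed
  have "T g = (\<lambda>s. \<Sum>b\<in>B. ell2_inner X (T g) b * b s)" by (rule B(4)[OF T[OF gU]])
  also have "\<dots> = (\<lambda>s. \<Sum>b\<in>B. k * (c b * b s))"
    by (intro ext sum.cong refl) (simp add: Tgb mult.assoc)
  also have "\<dots> = (\<lambda>s. k * g s)" by (simp add: g_def sum_distrib_left)
  finally have 1: "T g = (\<lambda>s. k * g s)" .
  have "g \<noteq> (\<lambda>_. 0)"
  proof
    assume "g = (\<lambda>_. 0)"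
    then have "c b = 0" if "b \<in> B" for b using gb[OF that] by (simp add: ell2_inner_fin)
    then have "vec_index v j = 0" if "j < n" for j using ce[OF that] eB[OF that] by metis
    then have "v = 0\<^sub>v n" using v(1) by (intro eq_vecI) auto
    then show False using v(2) by simp
  qed
  then show ?thesis using that 1 gU by blast
qed

text \<open>A maximal orthonormal set of eigenvectors is already a basis: by symmetry its orthogonal
  complement \<open>U'\<close> in \<open>U\<close> is invariant, and a nonzero complement would
  contain a further eigenvector.\<close>

lemma finite_dim_spectral:
  assumes U: "fun_subspace U" "U \<subseteq> {f. \<forall>s. s \<notin> X \<longrightarrow> f s = 0}"
    and T: "\<And>f. f \<in> U \<Longrightarrow> T f \<in> U"
    and lin: "\<And>B c. finite B \<Longrightarrow> B \<subseteq> U \<Longrightarrow> T (\<lambda>s. \<Sum>b\<in>B. c b * b s) = (\<lambda>s. \<Sum>b\<in>B. c b * T b s)"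
    and sym: "\<And>f g. f \<in> U \<Longrightarrow> g \<in> U \<Longrightarrow> ell2_inner X (T f) g = ell2_inner X f (T g)"
  obtains B where "finite B" "B \<subseteq> U" "fin_orthonormal B"
    "\<And>f. f \<in> U \<Longrightarrow> f = (\<lambda>s. \<Sum>b\<in>B. ell2_inner X f b * b s)"
    "\<And>b. b \<in> B \<Longrightarrow> \<exists>c. T b = (\<lambda>s. c * b s)"
proof -
  obtain B where B: "finite B" "B \<subseteq> U" "fin_orthonormal B" "\<forall>b\<in>B. \<exists>c. T b = (\<lambda>s. c * b s)"
    "\<And>B'. finite B' \<Longrightarrow> B' \<subseteq> U \<Longrightarrow> fin_orthonormal B' \<Longrightarrow> \<forall>b\<in>B'. \<exists>c. T b = (\<lambda>s. c * b s) \<Longrightarrow> card B' \<le> card B"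
    using maximal_orthonormal[of "\<lambda>B. \<forall>b\<in>B. \<exists>c. T b = (\<lambda>s. c * b s)" U] by auto
  define U' where "U' = {f \<in> U. \<forall>b\<in>B. ell2_inner X f b = 0}"
  have U': "fun_subspace U'"
    using U(1) by (auto simp: U'_def fun_subspace_def ell2_inner_add_left) (simp_all add: ell2_inner_fin)
  have supp': "U' \<subseteq> {f. \<forall>s. s \<notin> X \<longrightarrow> f s = 0}" using U(2) by (auto simp: U'_def)
  have T': "T f \<in> U'" if "f \<in> U'" for f
  proof -
    have "ell2_inner X (T f) b = 0" if b: "b \<in> B" for b
    proof -
      obtain c where "T b = (\<lambda>s. c * b s)" using B(4) b by blast
      then have "ell2_inner X (T f) b = ell2_inner X f (\<lambda>s. c * b s)"
        using sym[of f b] \<open>f \<in> U'\<close> b B(2) by (auto simp: U'_def)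
      also have "\<dots> = cnj c * ell2_inner X f b"
        unfolding ell2_inner_fin by (simp add: sum_distrib_left algebra_simps)
      finally show ?thesis using \<open>f \<in> U'\<close> b by (simp add: U'_def)
    qed
    then show ?thesis using that T by (auto simp: U'_def)
  qed
  have zero: "f = (\<lambda>_. 0)" if f: "f \<in> U'" for f
  proof (rule ccontr)
    assume "f \<noteq> (\<lambda>_. 0)"
    obtain g k where g: "g \<in> U'" "g \<noteq> (\<lambda>_. 0)" "T g = (\<lambda>s. k * g s)"
    proof (rule eigenvector_exists[of U' T f])
      show "T (\<lambda>s. \<Sum>b\<in>B. c b * b s) = (\<lambda>s. \<Sum>b\<in>B. c b * T b s)" if "finite B" "B \<subseteq> U'" for B c
        using that by (intro lin) (auto simp: U'_def)
    qed (use U' supp' T' f \<open>f \<noteq> (\<lambda>_. 0)\<close> in auto)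
    have gU: "g \<in> U" "\<forall>b\<in>B. ell2_inner X g b = 0" using g(1) by (auto simp: U'_def)
    from orthonormal_extend[of U, OF U B(1-3) gU(1) g(2) gU(2)] obtain c where
      c: "(\<lambda>s. c * g s) \<in> U" "(\<lambda>s. c * g s) \<notin> B" "fin_orthonormal (insert (\<lambda>s. c * g s) B)" by blast
    \<comment> \<open>Linearity is given for sums over finite sets of functions; the sum over
      \<open>{g}\<close> extracts homogeneity from it.\<close>
    have "T (\<lambda>s. \<Sum>b\<in>{g}. c * b s) = (\<lambda>s. \<Sum>b\<in>{g}. c * T b s)" using gU by (intro lin) auto
    then have "T (\<lambda>s. c * g s) = (\<lambda>s. k * (c * g s))" using g(3) by (simp add: mult.left_commute)
    then have "\<forall>b\<in>insert (\<lambda>s. c * g s) B. \<exists>c. T b = (\<lambda>s. c * b s)" using B(4) by blast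
    then have "card (insert (\<lambda>s. c * g s) B) \<le> card B"
      using B c by (intro B(5)) auto
    then show False using c(2) B(1) by simp
  qed
  have "f = (\<lambda>s. \<Sum>b\<in>B. ell2_inner X f b * b s)" if f: "f \<in> U" for f
  proof -
    define g where "g = (\<lambda>s. f s - (\<Sum>b\<in>B. ell2_inner X f b * b s))"
    have g: "g \<in> U" unfolding g_def using B f
      by (intro fun_subspace_diff fun_subspace_sum U) auto
    have gb: "\<forall>b\<in>B. ell2_inner X g b = 0"
      unfolding g_def by (simp add: ell2_inner_diff_left ell2_inner_expansion[OF B(1,3)])
    have "g = (\<lambda>_. 0)" using g gb by (intro zero) (auto simp: U'_def)
    then show ?thesis unfolding g_def by (metis (no_types, lifting) eq_iff_diff_eq_0)
  qed
  from that[OF B(1-3) this] B(4) show ?thesis by blast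
qed

end

subsection \<open>Orthogonal families of invariant subspaces\<close>

text \<open>One of the two functions has to vanish at each point outside \<open>X\<close>. With
  \<open>X = {}\<close> this yields orthogonality of functions with disjoint supports.\<close>

lemma ell2_inner_restrict:
  assumes "X \<subseteq> S" "\<And>s. s \<notin> X \<Longrightarrow> f s = 0 \<or> g s = 0"
  shows "ell2_inner S f g = ell2_inner X f g"
  unfolding ell2_inner_def using assms by (intro infsum_cong_neutral) auto

text \<open>The factors 2 come from |a + b|^2 <= 2|a|^2 + 2|b|^2. They are harmless for density and
  keep the estimates at the level of squared norms.\<close>

lemma ell2_add:
  assumes f: "f \<in> ell2 S" and g: "g \<in> ell2 S"
  shows "(\<lambda>s. f s + c * g s) \<in> ell2 S"
    and "(\<Sum>\<^sub>\<infinity>s\<in>S. (cmod (f s + c * g s))\<^sup>2)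
      \<le> 2 * (\<Sum>\<^sub>\<infinity>s\<in>S. (cmod (f s))\<^sup>2) + 2 * (cmod c)\<^sup>2 * (\<Sum>\<^sub>\<infinity>s\<in>S. (cmod (g s))\<^sup>2)"
proof -
  let ?F = "\<lambda>s. 2 * (cmod (f s))\<^sup>2 + 2 * (cmod c)\<^sup>2 * (cmod (g s))\<^sup>2"
  have le: "(cmod (f s + c * g s))\<^sup>2 \<le> ?F s" for s
  proof -
    have "(cmod (f s + c * g s))\<^sup>2 \<le> (cmod (f s) + cmod c * cmod (g s))\<^sup>2"
      by (intro power_mono) (auto intro: norm_triangle_le simp: norm_mult)
    also have "\<dots> \<le> ?F s"
      \<comment> \<open>The difference of the two sides is the square of
        \<open>cmod (f s) - cmod c * cmod (g s)\<close>.\<close>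
      using zero_le_power2[of "cmod (f s) - cmod c * cmod (g s)"]
      by (simp add: power2_eq_square algebra_simps)
    finally show ?thesis .
  qed
  have sf: "(\<lambda>s. (cmod (f s))\<^sup>2) summable_on S" "(\<lambda>s. (cmod (g s))\<^sup>2) summable_on S"
    using f g by (auto simp: ell2_def)
  have F: "?F summable_on S"
    using sf by (intro summable_on_add summable_on_cmult_right)
  have sum: "(\<lambda>s. (cmod (f s + c * g s))\<^sup>2) summable_on S"
    using F by (rule summable_on_comparison_test) (use le in auto)
  show "(\<lambda>s. f s + c * g s) \<in> ell2 S" using f g sum by (auto simp: ell2_def)
  have "(\<Sum>\<^sub>\<infinity>s\<in>S. (cmod (f s + c * g s))\<^sup>2) \<le> (\<Sum>\<^sub>\<infinity>s\<in>S. ?F s)"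
    using sum F le by (intro infsum_mono)
  also have "\<dots> = (\<Sum>\<^sub>\<infinity>s\<in>S. 2 * (cmod (f s))\<^sup>2) + (\<Sum>\<^sub>\<infinity>s\<in>S. 2 * (cmod c)\<^sup>2 * (cmod (g s))\<^sup>2)"
    using sf by (intro infsum_add summable_on_cmult_right)
  also have "\<dots> = 2 * (\<Sum>\<^sub>\<infinity>s\<in>S. (cmod (f s))\<^sup>2) + 2 * (cmod c)\<^sup>2 * (\<Sum>\<^sub>\<infinity>s\<in>S. (cmod (g s))\<^sup>2)"
    using sf by (simp add: infsum_cmult_right)
  finally show "(\<Sum>\<^sub>\<infinity>s\<in>S. (cmod (f s + c * g s))\<^sup>2)
      \<le> 2 * (\<Sum>\<^sub>\<infinity>s\<in>S. (cmod (f s))\<^sup>2) + 2 * (cmod c)\<^sup>2 * (\<Sum>\<^sub>\<infinity>s\<in>S. (cmod (g s))\<^sup>2)" .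
qed

lemma fun_subspace_ell2: "fun_subspace (ell2 S)"
  using ell2_add(1) by (auto simp: fun_subspace_def) (simp add: ell2_def)

lemma finite_support_ell2:
  assumes "finite X" "X \<subseteq> S" "\<And>s. s \<notin> X \<Longrightarrow> f s = 0"
  shows "f \<in> ell2 S" "(\<Sum>\<^sub>\<infinity>s\<in>S. (cmod (f s))\<^sup>2) = (\<Sum>s\<in>X. (cmod (f s))\<^sup>2)"
proof -
  have "(\<lambda>s. (cmod (f s))\<^sup>2) summable_on S \<longleftrightarrow> (\<lambda>s. (cmod (f s))\<^sup>2) summable_on X"
    using assms by (intro summable_on_cong_neutral) auto
  then show "f \<in> ell2 S" using assms by (auto simp: ell2_def)
  have "(\<Sum>\<^sub>\<infinity>s\<in>S. (cmod (f s))\<^sup>2) = (\<Sum>\<^sub>\<infinity>s\<in>X. (cmod (f s))\<^sup>2)"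
    using assms by (intro infsum_cong_neutral) auto
  then show "(\<Sum>\<^sub>\<infinity>s\<in>S. (cmod (f s))\<^sup>2) = (\<Sum>s\<in>X. (cmod (f s))\<^sup>2)"
    using assms(1) by simp
qed

text \<open>Norm closure, expressed through squared distances. A divergent sum of squares has the
  value 0 here, so the notion is meaningful only for \<open>V\<close> inside \<open>ell2 S\<close>,
  and it is used only there.\<close>

definition ell2_closure :: "'a set \<Rightarrow> ('a \<Rightarrow> complex) set \<Rightarrow> ('a \<Rightarrow> complex) set" where
  "ell2_closure S V = {f \<in> ell2 S. \<forall>e>0. \<exists>h\<in>V. (\<Sum>\<^sub>\<infinity>s\<in>S. (cmod (f s - h s))\<^sup>2) < e}"

lemma fun_subspace_closure:
  assumes V: "fun_subspace V" "V \<subseteq> ell2 S"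
  shows "fun_subspace (ell2_closure S V)"
  unfolding fun_subspace_def
proof (intro conjI ballI allI)
  have "\<exists>h\<in>V. (\<Sum>\<^sub>\<infinity>s\<in>S. (cmod (0 - h s))\<^sup>2) < e" if "e > 0" for e
    using V(1) that by (intro bexI[of _ "\<lambda>_. 0"]) (auto simp: fun_subspace_def)
  then show "(\<lambda>_. 0) \<in> ell2_closure S V"
    using fun_subspace_ell2[of S] by (simp add: ell2_closure_def fun_subspace_def)
next
  fix f g c
  assume f: "f \<in> ell2_closure S V" and g: "g \<in> ell2_closure S V"
  have "\<exists>h\<in>V. (\<Sum>\<^sub>\<infinity>s\<in>S. (cmod (f s + c * g s - h s))\<^sup>2) < e" if e: "e > 0" for e
  proof -
    \<comment> \<open>Chosen so that the total error \<open>2 * d + 2 * (cmod c)\<^sup>2 * d\<close>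
      equals \<open>e / 2\<close>.\<close>
    define d where "d = e / (4 * ((cmod c)\<^sup>2 + 1))"
    have c1: "(cmod c)\<^sup>2 + 1 > 0" by (simp add: add_nonneg_pos)
    have d: "d > 0" unfolding d_def using e c1 by simp
    obtain h where h: "h \<in> V" "(\<Sum>\<^sub>\<infinity>s\<in>S. (cmod (f s - h s))\<^sup>2) < d"
      using f d by (auto simp: ell2_closure_def)
    obtain k where k: "k \<in> V" "(\<Sum>\<^sub>\<infinity>s\<in>S. (cmod (g s - k s))\<^sup>2) < d"
      using g d by (auto simp: ell2_closure_def)
    have fh: "(\<lambda>s. f s - h s) \<in> ell2 S"
      using f h V(2) by (intro fun_subspace_diff[OF fun_subspace_ell2]) (auto simp: ell2_closure_def)
    have gk: "(\<lambda>s. g s - k s) \<in> ell2 S"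
      using g k V(2) by (intro fun_subspace_diff[OF fun_subspace_ell2]) (auto simp: ell2_closure_def)
    have "(\<Sum>\<^sub>\<infinity>s\<in>S. (cmod (f s + c * g s - (h s + c * k s)))\<^sup>2)
        = (\<Sum>\<^sub>\<infinity>s\<in>S. (cmod (f s - h s + c * (g s - k s)))\<^sup>2)"
      by (simp add: algebra_simps)
    also have "\<dots> \<le> 2 * (\<Sum>\<^sub>\<infinity>s\<in>S. (cmod (f s - h s))\<^sup>2) + 2 * (cmod c)\<^sup>2 * (\<Sum>\<^sub>\<infinity>s\<in>S. (cmod (g s - k s))\<^sup>2)"
      by (rule ell2_add(2)[OF fh gk])
    also have "\<dots> \<le> 2 * d + 2 * (cmod c)\<^sup>2 * d"
      using h(2) k(2) by (intro add_mono mult_left_mono) auto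
    also have "\<dots> = 2 * ((cmod c)\<^sup>2 + 1) * d" by (simp add: algebra_simps)
    also have "\<dots> = e / 2" unfolding d_def using c1 by (simp add: field_simps)
    also have "\<dots> < e" using e by simp
    finally show ?thesis
      using fun_subspace_add[OF V(1) h(1) k(1), of c] by (intro bexI[of _ "\<lambda>s. h s + c * k s"]) auto
  qed
  then show "(\<lambda>s. f s + c * g s) \<in> ell2_closure S V"
    using f g ell2_add(1)[of f S g c] by (auto simp: ell2_closure_def)
qed

text \<open>Truncating \<open>f\<close> to a finite set leaves a small tail, and the truncation is a
  finite combination of point masses, so only point masses have to be approximated.\<close>

lemma ell2_closure_eq_ell2:
  assumes V: "fun_subspace V" "V \<subseteq> ell2 S"
    and delta: "\<And>s. s \<in> S \<Longrightarrow> (\<lambda>t. of_bool (t = s)) \<in> ell2_closure S V"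
  shows "ell2_closure S V = ell2 S"
proof
  show "ell2 S \<subseteq> ell2_closure S V"
  proof
    fix f assume f: "f \<in> ell2 S"
    have fS: "(\<lambda>s. (cmod (f s))\<^sup>2) summable_on S" using f by (simp add: ell2_def)
    have "\<exists>h\<in>V. (\<Sum>\<^sub>\<infinity>s\<in>S. (cmod (f s - h s))\<^sup>2) < e" if e: "e > 0" for e
    proof -
      \<comment> \<open>Tail and approximation of the truncation each cost at most
        \<open>e / 8\<close>; \<open>ell2_add\<close> doubles both, which leaves a total of at most
        \<open>e / 2\<close>.\<close>
      obtain X where X: "finite X" "X \<subseteq> S"
        "dist (\<Sum>s\<in>X. (cmod (f s))\<^sup>2) (\<Sum>\<^sub>\<infinity>s\<in>S. (cmod (f s))\<^sup>2) \<le> e / 8"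
        using infsum_finite_approximation[OF fS, of "e/8"] e by auto
      define f0 where "f0 = (\<lambda>t. \<Sum>s\<in>X. f s * of_bool (t = s))"
      have f0: "f0 t = (if t \<in> X then f t else 0)" for t
      proof -
        have "f0 t = (\<Sum>s\<in>X. if s = t then f t else 0)"
          unfolding f0_def by (intro sum.cong) auto
        then show ?thesis using X(1) by simp
      qed
      have "f0 \<in> ell2_closure S V"
        unfolding f0_def using X delta
        by (intro fun_subspace_sum[OF fun_subspace_closure[OF V], of _ "\<lambda>s t. of_bool (t = s)"]) auto
      then obtain h where h: "h \<in> V" "(\<Sum>\<^sub>\<infinity>s\<in>S. (cmod (f0 s - h s))\<^sup>2) < e / 8"
        using e by (auto simp: ell2_closure_def elim!: allE[of _ "e/8"])
      have f0S: "f0 \<in> ell2 S" using X f0 by (intro finite_support_ell2[of X]) auto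
      have l: "(\<lambda>s. f s - f0 s) \<in> ell2 S" "(\<lambda>s. f0 s - h s) \<in> ell2 S"
        using f f0S h V(2) by (auto intro!: fun_subspace_diff[OF fun_subspace_ell2])
      have "(\<Sum>\<^sub>\<infinity>s\<in>S. (cmod (f s - f0 s))\<^sup>2) = (\<Sum>\<^sub>\<infinity>s\<in>S-X. (cmod (f s))\<^sup>2)"
        by (intro infsum_cong_neutral) (auto simp: f0)
      also have "\<dots> = (\<Sum>\<^sub>\<infinity>s\<in>S. (cmod (f s))\<^sup>2) - (\<Sum>s\<in>X. (cmod (f s))\<^sup>2)"
        using X fS by (subst infsum_Diff) auto
      also have "\<dots> \<le> e / 8" using X(3) unfolding dist_real_def by linarith
      finally have 1: "(\<Sum>\<^sub>\<infinity>s\<in>S. (cmod (f s - f0 s))\<^sup>2) \<le> e / 8" .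
      have "(\<Sum>\<^sub>\<infinity>s\<in>S. (cmod (f s - h s))\<^sup>2) = (\<Sum>\<^sub>\<infinity>s\<in>S. (cmod (f s - f0 s + 1 * (f0 s - h s)))\<^sup>2)"
        by simp
      also have "\<dots> \<le> 2 * (\<Sum>\<^sub>\<infinity>s\<in>S. (cmod (f s - f0 s))\<^sup>2) + 2 * (cmod 1)\<^sup>2 * (\<Sum>\<^sub>\<infinity>s\<in>S. (cmod (f0 s - h s))\<^sup>2)"
        by (rule ell2_add(2)[OF l])
      also have "\<dots> < e" using 1 h(2) e by simp
      finally show ?thesis using h(1) by blast
    qed
    then show "f \<in> ell2_closure S V" using f by (simp add: ell2_closure_def)
  qed
qed (auto simp: ell2_closure_def)

section \<open>Linear spans and completeness\<close>

definition fun_span :: "('a \<Rightarrow> complex) set \<Rightarrow> ('a \<Rightarrow> complex) set" where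
  "fun_span B = {\<lambda>s. \<Sum>b\<in>F. c b * b s | F c. finite F \<and> F \<subseteq> B}"

lemma fun_subspace_span: "fun_subspace (fun_span B)"
  unfolding fun_subspace_def
proof (intro conjI ballI allI)
  show "(\<lambda>_. 0) \<in> fun_span B" unfolding fun_span_def by (intro CollectI exI[of _ "{}"]) auto
next
  fix f g k
  assume "f \<in> fun_span B" "g \<in> fun_span B"
  then obtain F c G d where F: "finite F" "F \<subseteq> B" "f = (\<lambda>s. \<Sum>b\<in>F. c b * b s)"
    and G: "finite G" "G \<subseteq> B" "g = (\<lambda>s. \<Sum>b\<in>G. d b * b s)"
    unfolding fun_span_def by blast
  \<comment> \<open>Extending both coefficient families by zero lets the two sums run over the same
    set, overlap included.\<close>
  let ?c = "\<lambda>b. (if b \<in> F then c b else 0) + k * (if b \<in> G then d b else 0)"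
  have "f s + k * g s = (\<Sum>b\<in>F\<union>G. ?c b * b s)" for s
  proof -
    have "f s = (\<Sum>b\<in>F\<union>G. (if b \<in> F then c b else 0) * b s)"
      unfolding F(3) using F(1) G(1) by (intro sum.mono_neutral_cong_left) auto
    moreover have "g s = (\<Sum>b\<in>F\<union>G. (if b \<in> G then d b else 0) * b s)"
      unfolding G(3) using F(1) G(1) by (intro sum.mono_neutral_cong_left) auto
    ultimately have "f s + k * g s = (\<Sum>b\<in>F\<union>G. (if b \<in> F then c b else 0) * b s) +
        k * (\<Sum>b\<in>F\<union>G. (if b \<in> G then d b else 0) * b s)" by (rule arg_cong2)
    also have "\<dots> = (\<Sum>b\<in>F\<union>G. ?c b * b s)"
      unfolding sum_distrib_left sum.distrib[symmetric] distrib_right mult.assoc ..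
    finally show ?thesis .
  qed
  then show "(\<lambda>s. f s + k * g s) \<in> fun_span B"
    unfolding fun_span_def using F G by (intro CollectI exI[of _ "F \<union> G"] exI[of _ ?c]) auto
qed

lemma fun_span_subset:
  assumes "fun_subspace U" "B \<subseteq> U" shows "fun_span B \<subseteq> U"
  using assms fun_subspace_sum[of U _ "\<lambda>b. b"] unfolding fun_span_def by blast

lemma complete_if_closure_span:
  assumes "orthonormal_system S B" "ell2_closure S (fun_span B) = ell2 S"
  shows "complete_orthonormal_system S B"
  unfolding complete_orthonormal_system_def
proof (intro conjI assms(1) ballI allI impI)
  fix f and e :: real assume f: "f \<in> ell2 S" and e: "e > 0"
  then have "f \<in> ell2_closure S (fun_span B)" using assms(2) by simp
  \<comment> \<open>The closure measures squared distances, hence \<open>e\<^sup>2\<close>.\<close>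
  then obtain h where h: "h \<in> fun_span B" "(\<Sum>\<^sub>\<infinity>s\<in>S. (cmod (f s - h s))\<^sup>2) < e\<^sup>2"
    using e by (auto simp: ell2_closure_def elim!: allE[of _ "e\<^sup>2"])
  then obtain F c where F: "finite F" "F \<subseteq> B" "h = (\<lambda>s. \<Sum>b\<in>F. c b * b s)"
    unfolding fun_span_def by blast
  have "ell2_norm S (\<lambda>s. f s - h s) < e"
    unfolding ell2_norm_def using h(2) e real_less_lsqrt by (metis less_imp_le real_sqrt_less_mono real_sqrt_unique)
  then show "\<exists>F c. finite F \<and> F \<subseteq> B \<and> ell2_norm S (\<lambda>s. f s - (\<Sum>b\<in>F. c b * b s)) < e"
    using F by auto
qed

text \<open>The reproducing kernel \<open>k i\<close> of \<open>U i\<close> at \<open>s\<close> satisfies \<open>k i s = \<parallel>P\<^sub>i \<delta>\<^sub>s\<parallel>\<^sup>2\<close> for the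
  orthogonal projection \<open>P\<^sub>i\<close> onto \<open>U i\<close>, so the last assumption is Parseval's equality for \<open>\<delta>\<^sub>s\<close>.\<close>

lemma eigenbasis_of_orthogonal_family:
  assumes X: "\<And>i. i \<in> I \<Longrightarrow> finite (X i)" "\<And>i. i \<in> I \<Longrightarrow> X i \<subseteq> S"
    and U: "\<And>i. i \<in> I \<Longrightarrow> fun_subspace (U i)"
      "\<And>i. i \<in> I \<Longrightarrow> U i \<subseteq> {f. \<forall>s. s \<notin> X i \<longrightarrow> f s = 0}"
    and T: "\<And>i f. i \<in> I \<Longrightarrow> f \<in> U i \<Longrightarrow> T f \<in> U i"
    and lin: "\<And>i B c. i \<in> I \<Longrightarrow> finite B \<Longrightarrow> B \<subseteq> U i \<Longrightarrow>
      T (\<lambda>s. \<Sum>b\<in>B. c b * b s) = (\<lambda>s. \<Sum>b\<in>B. c b * T b s)"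
    and sym: "\<And>i f g. i \<in> I \<Longrightarrow> f \<in> U i \<Longrightarrow> g \<in> U i \<Longrightarrow> ell2_inner S (T f) g = ell2_inner S f (T g)"
    and orth: "\<And>i j f g. i \<in> I \<Longrightarrow> j \<in> I \<Longrightarrow> i \<noteq> j \<Longrightarrow> f \<in> U i \<Longrightarrow> g \<in> U j \<Longrightarrow> ell2_inner S f g = 0"
    and kernel: "\<And>s e. s \<in> S \<Longrightarrow> e > 0 \<Longrightarrow> \<exists>J k. finite J \<and> J \<subseteq> I \<and>
      (\<forall>i\<in>J. k i \<in> U i \<and> (\<forall>f\<in>U i. ell2_inner S f (k i) = f s)) \<and> (\<Sum>i\<in>J. Re (k i s)) > 1 - e"
  shows "\<exists>B. complete_orthonormal_system S B \<and>
    (\<forall>f\<in>B. finitely_supported f \<and> eigenfunction_on_ell2 S T f)"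
proof -
  have "\<exists>B. finite B \<and> B \<subseteq> U i \<and> fin_orthonormal (X i) B \<and>
      (\<forall>f\<in>U i. f = (\<lambda>s. \<Sum>b\<in>B. ell2_inner (X i) f b * b s)) \<and> (\<forall>b\<in>B. \<exists>c. T b = (\<lambda>s. c * b s))"
    if i: "i \<in> I" for i
  proof -
    have sym': "ell2_inner (X i) (T f) g = ell2_inner (X i) f (T g)" if "f \<in> U i" "g \<in> U i" for f g
      using sym[OF i that] U(2)[OF i] that by (subst (1 2) ell2_inner_restrict[symmetric, OF X(2)[OF i]]) auto
    show ?thesis
      by (rule finite_dim_spectral[OF X(1)[OF i] U(1)[OF i] U(2)[OF i] T[OF i] lin[OF i] sym'])
        (assumption | blast)+
  qed
  then have "\<forall>i\<in>I. \<exists>B. finite B \<and> B \<subseteq> U i \<and> fin_orthonormal (X i) B \<and>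
      (\<forall>f\<in>U i. f = (\<lambda>s. \<Sum>b\<in>B. ell2_inner (X i) f b * b s)) \<and> (\<forall>b\<in>B. \<exists>c. T b = (\<lambda>s. c * b s))"
    by (rule ballI)
  from bchoice[OF this] obtain Bs where "\<forall>i\<in>I. finite (Bs i) \<and> Bs i \<subseteq> U i \<and> fin_orthonormal (X i) (Bs i) \<and>
      (\<forall>f\<in>U i. f = (\<lambda>s. \<Sum>b\<in>Bs i. ell2_inner (X i) f b * b s)) \<and> (\<forall>b\<in>Bs i. \<exists>c. T b = (\<lambda>s. c * b s))" ..
  then have Bs: "\<And>i. i \<in> I \<Longrightarrow> finite (Bs i)" "\<And>i. i \<in> I \<Longrightarrow> Bs i \<subseteq> U i"
    "\<And>i. i \<in> I \<Longrightarrow> fin_orthonormal (X i) (Bs i)"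
    "\<And>i f. i \<in> I \<Longrightarrow> f \<in> U i \<Longrightarrow> f = (\<lambda>s. \<Sum>b\<in>Bs i. ell2_inner (X i) f b * b s)"
    "\<And>i b. i \<in> I \<Longrightarrow> b \<in> Bs i \<Longrightarrow> \<exists>c. T b = (\<lambda>s. c * b s)"
    by blast+
  define B where "B = (\<Union>i\<in>I. Bs i)"
  have innerX: "ell2_inner (X i) f g = ell2_inner S f g" if "i \<in> I" "f \<in> U i" for i f g
    using U(2)[OF that(1)] that(2) by (intro ell2_inner_restrict[symmetric, OF X(2)[OF that(1)]]) auto
  have on: "ell2_inner S b b' = (if b = b' then 1 else 0)"
    if "i \<in> I" "j \<in> I" "b \<in> Bs i" "b' \<in> Bs j" for i j b b'
  proof -
    have bU: "b \<in> U i" "b' \<in> U j" using Bs(2) that by auto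
    have same: "ell2_inner S c c' = (if c = c' then 1 else 0)" if "c \<in> Bs i" "c' \<in> Bs i" for c c'
    proof -
      have "ell2_inner (X i) c c' = (if c = c' then 1 else 0)"
        using Bs(3)[OF \<open>i \<in> I\<close>] that unfolding fin_orthonormal_def[OF X(1)[OF \<open>i \<in> I\<close>]] by blast
      then show ?thesis using innerX[OF \<open>i \<in> I\<close>, of c c'] Bs(2)[OF \<open>i \<in> I\<close>] that(1) by auto
    qed
    show ?thesis
    proof (cases "i = j")
      case True
      then show ?thesis using same that by blast
    next
      case False
      \<comment> \<open>An element common to two different blocks would be orthogonal to itself,
        although its norm is 1.\<close>
      have "b \<noteq> b'"
        using orth[OF that(1,2) False bU] same[OF that(3,3)] by auto
      then show ?thesis using orth[OF that(1,2) False bU] by simp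
    qed
  qed
  have disj: "Bs i \<inter> Bs j = {}" if "i \<in> I" "j \<in> I" "i \<noteq> j" for i j
  proof (rule ccontr)
    assume "Bs i \<inter> Bs j \<noteq> {}"
    then obtain b where "b \<in> Bs i" "b \<in> Bs j" by blast
    then show False using on[OF that(1,2), of b b] orth[OF that, of b b] Bs(2) that by auto
  qed
  have ell2U: "U i \<subseteq> ell2 S" if "i \<in> I" for i
    using finite_support_ell2(1)[OF X(1)[OF that] X(2)[OF that]] U(2)[OF that] by blast
  have Bell2: "B \<subseteq> ell2 S" unfolding B_def by (intro UN_least) (use Bs(2) ell2U in \<open>rule subset_trans\<close>)
  have ons: "orthonormal_system S B"
    unfolding orthonormal_system_def
  proof (intro conjI Bell2 ballI)
    fix b b' assume "b \<in> B" "b' \<in> B"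
    then obtain i j where "i \<in> I" "b \<in> Bs i" "j \<in> I" "b' \<in> Bs j" by (auto simp: B_def)
    then show "ell2_inner S b b' = (if b = b' then 1 else 0)" using on[of i j b b'] by blast
  qed
  have "ell2_closure S (fun_span B) = ell2 S"
  proof (intro ell2_closure_eq_ell2 fun_subspace_span fun_span_subset fun_subspace_ell2 Bell2)
    fix s assume s: "s \<in> S"
    let ?d = "\<lambda>t. of_bool (t = s) :: complex"
    have "\<exists>h\<in>fun_span B. (\<Sum>\<^sub>\<infinity>t\<in>S. (cmod (?d t - h t))\<^sup>2) < e" if e: "e > 0" for e
    proof -
      obtain J k where J: "finite J" "J \<subseteq> I" "\<And>i. i \<in> J \<Longrightarrow> k i \<in> U i"
        "\<And>i f. i \<in> J \<Longrightarrow> f \<in> U i \<Longrightarrow> ell2_inner S f (k i) = f s" "(\<Sum>i\<in>J. Re (k i s)) > 1 - e"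
        using kernel[OF s e] by blast
      define F where "F = (\<Union>i\<in>J. Bs i)"
      \<comment> \<open>A finite set carrying all functions involved. The point \<open>s\<close> is
        added because the point mass at \<open>s\<close> must live on \<open>Y\<close> too.\<close>
      define Y where "Y = insert s (\<Union>i\<in>J. X i)"
      have F: "finite F" "F \<subseteq> B" using J Bs(1) by (auto simp: F_def B_def)
      have "(\<Union>i\<in>J. X i) \<subseteq> S" by (intro UN_least X(2) subsetD[OF J(2)])
      then have Y: "finite Y" "Y \<subseteq> S" "s \<in> Y"
        using J(1) X(1) subsetD[OF J(2)] s by (auto simp: Y_def)
      have FY: "b t = 0" if "b \<in> F" "t \<notin> Y" for b t
      proof -
        obtain i where "i \<in> J" "b \<in> Bs i" using \<open>b \<in> F\<close> by (auto simp: F_def)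
        moreover from this have "t \<notin> X i" using \<open>t \<notin> Y\<close> \<open>i \<in> J\<close> by (auto simp: Y_def)
        moreover have "i \<in> I" using J(2) \<open>i \<in> J\<close> by blast
        ultimately have "b \<in> {f. \<forall>s. s \<notin> X i \<longrightarrow> f s = 0}" using U(2)[of i] Bs(2)[of i] by blast
        then show ?thesis using \<open>t \<notin> X i\<close> by simp
      qed
      have onF: "fin_orthonormal Y F"
        unfolding fin_orthonormal_def[OF Y(1)]
      proof (intro ballI)
        fix b b' assume b: "b \<in> F" "b' \<in> F"
        have "ell2_inner Y b b' = ell2_inner S b b'"
          using FY b Y by (intro ell2_inner_restrict[symmetric]) auto
        then show "ell2_inner Y b b' = (if b = b' then 1 else 0)"
          using b on J(2) unfolding F_def by (metis UN_E subsetD)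
      qed
      \<comment> \<open>Parseval inside \<open>U i\<close>: by the reproducing property the
        coefficient of \<open>k i\<close> along \<open>b\<close> is \<open>cnj (b s)\<close>, so
        evaluating the expansion of \<open>k i\<close> at \<open>s\<close> gives the sum of
        squares.\<close>
      have sumk: "(\<Sum>b\<in>Bs i. (cmod (b s))\<^sup>2) = Re (k i s)" if i: "i \<in> J" for i
      proof -
        have iI: "i \<in> I" using i J(2) by auto
        have kb: "ell2_inner (X i) (k i) b = cnj (b s)" if b: "b \<in> Bs i" for b
        proof -
          have bU: "b \<in> U i" using Bs(2) iI b by auto
          show ?thesis
            using J(4)[OF i bU] innerX[OF iI bU, of "k i"] ell2_inner_commute[OF X(1)[OF iI], of "k i" b] by simp
        qed
        have "k i s = (\<Sum>b\<in>Bs i. ell2_inner (X i) (k i) b * b s)"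
          using fun_cong[OF Bs(4)[OF iI J(3)[OF i]], of s] .
        also have "\<dots> = (\<Sum>b\<in>Bs i. of_real ((cmod (b s))\<^sup>2))"
          by (intro sum.cong refl) (simp add: kb complex_norm_square mult.commute del: of_real_power)
        finally show ?thesis by simp
      qed
      have "(\<Sum>b\<in>F. (cmod (b s))\<^sup>2) = (\<Sum>i\<in>J. \<Sum>b\<in>Bs i. (cmod (b s))\<^sup>2)"
        unfolding F_def
      proof (rule sum.UNION_disjoint)
        show "\<forall>i\<in>J. finite (Bs i)" using Bs(1) subsetD[OF J(2)] by blast
        show "\<forall>i\<in>J. \<forall>j\<in>J. i \<noteq> j \<longrightarrow> Bs i \<inter> Bs j = {}" using disj subsetD[OF J(2)] by blast
      qed (rule J(1))
      also have "\<dots> = (\<Sum>i\<in>J. Re (k i s))" by (rule sum.cong[OF refl sumk])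
      finally have big: "(\<Sum>b\<in>F. (cmod (b s))\<^sup>2) > 1 - e" using J(5) by simp
      define h where "h = (\<lambda>t. \<Sum>b\<in>F. ell2_inner Y ?d b * b t)"
      have "h \<in> fun_span B" unfolding fun_span_def h_def using F by blast
      have hY: "?d t - h t = 0" if "t \<notin> Y" for t
        using that Y(3) FY unfolding h_def by auto
      have "(\<Sum>\<^sub>\<infinity>t\<in>S. (cmod (?d t - h t))\<^sup>2) = (\<Sum>t\<in>Y. (cmod (?d t - h t))\<^sup>2)"
        by (rule finite_support_ell2(2)[OF Y(1,2) hY])
      \<comment> \<open>The squared error is exactly 1 minus the mass that \<open>F\<close> collects
        at \<open>s\<close>, which \<open>big\<close> bounds from below.\<close>
      also have "\<dots> = (\<Sum>t\<in>Y. (cmod (?d t))\<^sup>2) - (\<Sum>b\<in>F. (cmod (ell2_inner Y ?d b))\<^sup>2)"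
        unfolding h_def by (rule Bessel_identity[OF Y(1) F(1) onF])
      also have "(\<Sum>t\<in>Y. (cmod (?d t))\<^sup>2) = (\<Sum>t\<in>Y. if t = s then 1 else 0)"
        by (intro sum.cong) auto
      also have "\<dots> = 1" using Y by simp
      also have "(\<Sum>b\<in>F. (cmod (ell2_inner Y ?d b))\<^sup>2) = (\<Sum>b\<in>F. (cmod (b s))\<^sup>2)"
        by (simp add: ell2_inner_delta[OF Y(1,3)])
      finally have "(\<Sum>\<^sub>\<infinity>t\<in>S. (cmod (?d t - h t))\<^sup>2) < e" using big by simp
      with \<open>h \<in> fun_span B\<close> show ?thesis by blast
    qed
    moreover have "?d \<in> ell2 S" using s by (intro finite_support_ell2(1)[of "{s}"]) auto
    ultimately show "?d \<in> ell2_closure S (fun_span B)" by (simp add: ell2_closure_def)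
  qed
  then have "complete_orthonormal_system S B" by (rule complete_if_closure_span[OF ons])
  moreover have "finitely_supported b \<and> eigenfunction_on_ell2 S T b" if b: "b \<in> B" for b
  proof -
    obtain i where i: "i \<in> I" "b \<in> Bs i" using b unfolding B_def by blast
    have "b \<in> {f. \<forall>s. s \<notin> X i \<longrightarrow> f s = 0}" using i Bs(2)[OF i(1)] U(2)[OF i(1)] by blast
    then have "{s. b s \<noteq> 0} \<subseteq> X i" by blast
    then have "finite {s. b s \<noteq> 0}" using X(1)[OF i(1)] by (rule finite_subset)
    moreover have "b \<noteq> (\<lambda>_. 0)"
    proof
      assume "b = (\<lambda>_. 0)"
      then have "ell2_inner S b b = 0" by (simp add: ell2_inner_def)
      then show False using on[OF i(1,1,2,2)] by simp
    qed
    moreover have "b \<in> ell2 S" using b Bell2 by blast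
    ultimately show ?thesis
      using Bs(5)[OF i] unfolding finitely_supported_def eigenfunction_on_ell2_def by blast
  qed
  ultimately show ?thesis by blast
qed

subsection \<open>Sectors of open and closed lamps\<close>

definition agree :: "'v set \<Rightarrow> ('v \<Rightarrow> 'h) \<Rightarrow> ('v \<Rightarrow> 'h) set" where
  "agree A \<zeta> = {\<eta>. \<forall>z. z \<notin> A \<longrightarrow> \<eta> z = \<zeta> z}"

lemma finite_agree:
  fixes \<zeta> :: "'v \<Rightarrow> 'h::finite"
  assumes "finite A" shows "finite (agree A \<zeta>)"
proof (rule finite_subset)
  show "agree A \<zeta> \<subseteq> (\<lambda>g z. if z \<in> A then g z else \<zeta> z) ` (A \<rightarrow>\<^sub>E UNIV)"
  proof
    fix \<eta> assume "\<eta> \<in> agree A \<zeta>"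
    then have "\<eta> = (\<lambda>z. if z \<in> A then restrict \<eta> A z else \<zeta> z)" by (auto simp: agree_def)
    moreover have "restrict \<eta> A \<in> A \<rightarrow>\<^sub>E UNIV" by auto
    ultimately show "\<eta> \<in> (\<lambda>g z. if z \<in> A then g z else \<zeta> z) ` (A \<rightarrow>\<^sub>E UNIV)" by blast
  qed
  show "finite ((\<lambda>g z. if z \<in> A then g z else \<zeta> z) ` (A \<rightarrow>\<^sub>E (UNIV :: 'h set)))"
    using assms by (intro finite_imageI finite_PiE) auto
qed

lemma agree_empty [simp]: "agree {} \<zeta> = {\<zeta>}"
  by (auto simp: agree_def)

lemma agree_configs: "finite A \<Longrightarrow> \<zeta> \<in> configs off \<Longrightarrow> agree A \<zeta> \<subseteq> configs off"
proof
  fix \<eta> assume "finite A" "\<zeta> \<in> configs off" "\<eta> \<in> agree A \<zeta>"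
  then have "{x. \<eta> x \<noteq> off} \<subseteq> A \<union> {x. \<zeta> x \<noteq> off}" "finite (A \<union> {x. \<zeta> x \<noteq> off})"
    by (auto simp: agree_def configs_def)
  then show "\<eta> \<in> configs off" by (simp add: configs_def finite_subset)
qed

lemma agree_update: "z \<in> A \<Longrightarrow> \<eta>(z := h) \<in> agree A \<zeta> \<longleftrightarrow> \<eta> \<in> agree A \<zeta>"
  by (auto simp: agree_def)

lemma sum_agree_insert:
  fixes \<zeta> :: "'v \<Rightarrow> 'h::finite" and F :: "_ \<Rightarrow> complex"
  assumes "finite A" "z \<notin> A"
  shows "(\<Sum>\<eta>\<in>agree (insert z A) \<zeta>. F \<eta>) = (\<Sum>\<eta>\<in>agree A \<zeta>. \<Sum>h\<in>UNIV. F (\<eta>(z := h)))"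
proof -
  have "(\<Sum>\<eta>\<in>agree (insert z A) \<zeta>. F \<eta>) = (\<Sum>(\<eta>, h)\<in>agree A \<zeta> \<times> UNIV. F (\<eta>(z := h)))"
    \<comment> \<open>The lamp at \<open>z\<close> is reset to \<open>\<zeta> z\<close>, the value
      it has throughout \<open>agree A \<zeta>\<close> because \<open>z\<close> lies outside
      \<open>A\<close>.\<close>
    using assms by (intro sum.reindex_bij_witness[where i = "\<lambda>(\<eta>, h). \<eta>(z := h)" and
        j = "\<lambda>\<eta>. (\<eta>(z := \<zeta> z), \<eta> z)"]) (auto simp: agree_def fun_eq_iff)
  then show ?thesis by (simp add: sum.cartesian_product)
qed

text \<open>The lamps in \<open>C\<close> are open, those in \<open>D\<close> closed, and the others frozen in \<open>\<zeta>\<close>.\<close>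

definition sector :: "'v set \<Rightarrow> 'v set \<Rightarrow> 'v set \<Rightarrow> ('v \<Rightarrow> 'h::finite) \<Rightarrow> (('v \<Rightarrow> 'h) \<times> 'v \<Rightarrow> complex) set" where
  "sector W C D \<zeta> = {f.
     (\<forall>\<eta> x. f (\<eta>, x) \<noteq> 0 \<longrightarrow> x \<in> W \<and> \<eta> \<in> agree (C \<union> D) \<zeta>) \<and>
     (\<forall>z\<in>C. \<forall>\<eta> h x. f (\<eta>(z := h), x) = f (\<eta>, x)) \<and>
     (\<forall>z\<in>D. \<forall>\<eta> x. (\<Sum>h\<in>UNIV. f (\<eta>(z := h), x)) = 0)}"

lemma sectorD:
  assumes "f \<in> sector W C D \<zeta>"
  shows "x \<notin> W \<Longrightarrow> f (\<eta>, x) = 0" "\<eta> \<notin> agree (C \<union> D) \<zeta> \<Longrightarrow> f (\<eta>, x) = 0"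
    "z \<in> C \<Longrightarrow> f (\<eta>(z := h), x) = f (\<eta>, x)" "z \<in> D \<Longrightarrow> (\<Sum>h\<in>UNIV. f (\<eta>(z := h), x)) = 0"
proof -
  have "x \<in> W \<and> \<eta> \<in> agree (C \<union> D) \<zeta>" if "f (\<eta>, x) \<noteq> 0"
    using assms that by (simp add: sector_def)
  then show "x \<notin> W \<Longrightarrow> f (\<eta>, x) = 0" "\<eta> \<notin> agree (C \<union> D) \<zeta> \<Longrightarrow> f (\<eta>, x) = 0"
    by fastforce+
qed (use assms in \<open>simp_all add: sector_def\<close>)

text \<open>Used to pass between a configuration at which a point mass sits and the representative,
  \<open>off\<close> on \<open>C \<union> D\<close>, by which its sector is indexed.\<close>

lemma sector_cong: "agree (C \<union> D) \<zeta> = agree (C \<union> D) \<xi> \<Longrightarrow> sector W C D \<zeta> = sector W C D \<xi>"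
  by (simp add: sector_def)

lemma fun_subspace_sector: "fun_subspace (sector W C D \<zeta>)"
  unfolding fun_subspace_def
proof (intro conjI ballI allI)
  fix f g c assume f: "f \<in> sector W C D \<zeta>" and g: "g \<in> sector W C D \<zeta>"
  show "(\<lambda>s. f s + c * g s) \<in> sector W C D \<zeta>"
    unfolding sector_def mem_Collect_eq
  proof (intro conjI allI ballI impI)
    fix \<eta> x assume "f (\<eta>, x) + c * g (\<eta>, x) \<noteq> 0"
    then have "f (\<eta>, x) \<noteq> 0 \<or> g (\<eta>, x) \<noteq> 0" by auto
    then show "x \<in> W" "\<eta> \<in> agree (C \<union> D) \<zeta>" using sectorD(1,2)[OF f] sectorD(1,2)[OF g] by blast+
  next
    fix z \<eta> h x assume "z \<in> C"
    then show "f (\<eta>(z := h), x) + c * g (\<eta>(z := h), x) = f (\<eta>, x) + c * g (\<eta>, x)"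
      by (simp add: sectorD(3)[OF f] sectorD(3)[OF g])
  next
    fix z \<eta> x assume "z \<in> D"
    then show "(\<Sum>h\<in>UNIV. f (\<eta>(z := h), x) + c * g (\<eta>(z := h), x)) = 0"
      by (simp add: sum.distrib sum_distrib_left[symmetric] sectorD(4)[OF f] sectorD(4)[OF g])
  qed
qed (simp add: sector_def)

lemma sector_support: "sector W C D \<zeta> \<subseteq> {f. \<forall>s. s \<notin> agree (C \<union> D) \<zeta> \<times> W \<longrightarrow> f s = 0}"
proof (intro subsetI CollectI allI impI)
  fix f and s :: "('a \<Rightarrow> 'b) \<times> 'a"
  assume "f \<in> sector W C D \<zeta>" "s \<notin> agree (C \<union> D) \<zeta> \<times> W"
  then show "f s = 0" by (cases s) (auto intro: sectorD(1,2))
qed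

lemma sector_support_lamp_states:
  "finite (C \<union> D) \<Longrightarrow> \<zeta> \<in> configs off \<Longrightarrow> agree (C \<union> D) \<zeta> \<times> W \<subseteq> lamp_states off"
  using agree_configs[of "C \<union> D" \<zeta> off] by (simp add: lamp_states_def Sigma_mono)

lemma sector_inner:
  assumes "finite (C \<union> D)" "\<zeta> \<in> configs off" "f \<in> sector W C D \<zeta>"
  shows "ell2_inner (lamp_states off) f g = ell2_inner (agree (C \<union> D) \<zeta> \<times> W) f g"
  using sector_support_lamp_states[OF assms(1,2)] sector_support assms(3)
  by (intro ell2_inner_restrict) blast+

text \<open>Summing over the lamp at \<open>z\<close> before all others already gives zero.\<close>

lemma sum_balanced:
  fixes F :: "('v \<Rightarrow> 'h::finite) \<times> 'v \<Rightarrow> complex"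
  assumes "finite A" "z \<in> A" "\<And>\<eta> x. (\<Sum>h\<in>UNIV. F (\<eta>(z := h), x)) = 0"
  shows "(\<Sum>s\<in>agree A \<zeta> \<times> W. F s) = 0"
proof -
  have "(\<Sum>\<eta>\<in>agree A \<zeta>. F (\<eta>, x)) = 0" for x
    using sum_agree_insert[of "A - {z}" z "\<lambda>\<eta>. F (\<eta>, x)" \<zeta>] assms by (simp add: insert_absorb)
  then have "(\<Sum>x\<in>W. \<Sum>\<eta>\<in>agree A \<zeta>. F (\<eta>, x)) = 0" by simp
  then show ?thesis by (subst (asm) sum.swap) (simp add: sum.cartesian_product)
qed

text \<open>In the lamp at \<open>z\<close> one function is constant and the other has sum zero, so
  their product sums to zero over that lamp alone.\<close>

lemma sector_orthogonal:
  assumes fin: "finite (C \<union> D)" "finite W" and \<zeta>: "\<zeta> \<in> configs off"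
    and f: "f \<in> sector W C D \<zeta>" and g: "g \<in> sector W' C' D' \<zeta>'"
    and z: "z \<in> C \<inter> D' \<union> D \<inter> C'"
  shows "ell2_inner (lamp_states off) f g = 0"
proof -
  have "(\<Sum>h\<in>UNIV. f (\<eta>(z := h), x) * cnj (g (\<eta>(z := h), x))) = 0" for \<eta> x
  proof (cases "z \<in> C \<inter> D'")
    case True
    have "(\<Sum>h\<in>UNIV. f (\<eta>(z := h), x) * cnj (g (\<eta>(z := h), x))) = f (\<eta>, x) * cnj (\<Sum>h\<in>UNIV. g (\<eta>(z := h), x))"
      using True by (simp add: sectorD(3)[OF f] sum_distrib_left)
    then show ?thesis using True by (simp add: sectorD(4)[OF g] del: cnj_sum)
  next
    case False
    then have zD: "z \<in> D" and zC: "z \<in> C'" using z by blast+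
    have "(\<Sum>h\<in>UNIV. f (\<eta>(z := h), x) * cnj (g (\<eta>(z := h), x))) = (\<Sum>h\<in>UNIV. f (\<eta>(z := h), x)) * cnj (g (\<eta>, x))"
      by (simp add: sectorD(3)[OF g zC] sum_distrib_right)
    then show ?thesis by (simp add: sectorD(4)[OF f zD])
  qed
  then have "(\<Sum>s\<in>agree (C \<union> D) \<zeta> \<times> W. f s * cnj (g s)) = 0"
    using z fin by (intro sum_balanced[where z = z]) auto
  then show ?thesis
    using fin by (simp add: sector_inner[OF fin(1) \<zeta> f] ell2_inner_fin finite_agree)
qed

text \<open>Matrix entries of the averaging projection (lamps in \<open>C\<close>) and of its complement; the
  reproducing kernel is their tensor product.\<close>

definition lamp_factor :: "'v set \<Rightarrow> ('v \<Rightarrow> 'h::finite) \<Rightarrow> 'v \<Rightarrow> 'h \<Rightarrow> real" where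
  "lamp_factor C \<xi> z h = (if z \<in> C then 1 / real CARD('h) else of_bool (h = \<xi> z) - 1 / real CARD('h))"

definition sector_kernel ::
  "'v set \<Rightarrow> 'v set \<Rightarrow> ('v \<Rightarrow> 'h::finite) \<times> 'v \<Rightarrow> ('v \<Rightarrow> 'h) \<times> 'v \<Rightarrow> complex" where
  "sector_kernel C D = (\<lambda>(\<xi>, x) (\<eta>, y).
     if y = x \<and> \<eta> \<in> agree (C \<union> D) \<xi> then of_real (\<Prod>z\<in>C \<union> D. lamp_factor C \<xi> z (\<eta> z)) else 0)"

text \<open>Tensorisation: if each factor \<open>\<kappa> z\<close> evaluates the lamp at
  \<open>z\<close> in the state \<open>\<xi> z\<close>, their product evaluates all lamps of
  \<open>A\<close> simultaneously.\<close>

lemma sum_lamp_factors: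
  fixes \<phi> :: "('v \<Rightarrow> 'h::finite) \<Rightarrow> complex"
  assumes "finite A"
    and "\<And>z \<eta>. z \<in> A \<Longrightarrow> (\<Sum>h\<in>UNIV. \<phi> (\<eta>(z := h)) * of_real (\<kappa> z h)) = \<phi> (\<eta>(z := \<xi> z))"
  shows "(\<Sum>\<eta>\<in>agree A \<xi>. \<phi> \<eta> * of_real (\<Prod>z\<in>A. \<kappa> z (\<eta> z))) = \<phi> \<xi>"
  using assms
proof (induction A arbitrary: \<phi> rule: finite_induct)
  case (insert w A)
  \<comment> \<open>What remains of \<open>\<phi>\<close> after the lamp at \<open>w\<close> has
    been evaluated. The hypothesis passes to it because updates at different vertices
    commute.\<close>
  let ?\<phi> = "\<lambda>\<eta>. \<phi> (\<eta>(w := \<xi> w))"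
  have "(\<Sum>\<eta>\<in>agree (insert w A) \<xi>. \<phi> \<eta> * of_real (\<Prod>z\<in>insert w A. \<kappa> z (\<eta> z)))
      = (\<Sum>\<eta>\<in>agree A \<xi>. \<Sum>h\<in>UNIV. \<phi> (\<eta>(w := h)) * of_real (\<Prod>z\<in>insert w A. \<kappa> z ((\<eta>(w := h)) z)))"
    by (rule sum_agree_insert[OF insert(1,2)])
  also have "\<dots> = (\<Sum>\<eta>\<in>agree A \<xi>. ?\<phi> \<eta> * of_real (\<Prod>z\<in>A. \<kappa> z (\<eta> z)))"
  proof (intro sum.cong refl)
    fix \<eta>
    have "(\<Prod>z\<in>insert w A. \<kappa> z ((\<eta>(w := h)) z)) = \<kappa> w h * (\<Prod>z\<in>A. \<kappa> z (\<eta> z))" for h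
    proof -
      have "(\<Prod>z\<in>A. \<kappa> z ((\<eta>(w := h)) z)) = (\<Prod>z\<in>A. \<kappa> z (\<eta> z))"
        using insert(2) by (intro prod.cong) auto
      then show ?thesis using insert(1,2) by simp
    qed
    then have "(\<Sum>h\<in>UNIV. \<phi> (\<eta>(w := h)) * of_real (\<Prod>z\<in>insert w A. \<kappa> z ((\<eta>(w := h)) z)))
       = (\<Sum>h\<in>UNIV. \<phi> (\<eta>(w := h)) * of_real (\<kappa> w h)) * of_real (\<Prod>z\<in>A. \<kappa> z (\<eta> z))"
      by (simp only: of_real_mult sum_distrib_right mult.assoc)
    also have "(\<Sum>h\<in>UNIV. \<phi> (\<eta>(w := h)) * of_real (\<kappa> w h)) = ?\<phi> \<eta>"
      by (rule insert.prems) simp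
    finally show "(\<Sum>h\<in>UNIV. \<phi> (\<eta>(w := h)) * of_real (\<Prod>z\<in>insert w A. \<kappa> z ((\<eta>(w := h)) z)))
       = ?\<phi> \<eta> * of_real (\<Prod>z\<in>A. \<kappa> z (\<eta> z))" .
  qed
  also have "\<dots> = ?\<phi> \<xi>"
  proof (rule insert.IH)
    fix z \<eta> assume z: "z \<in> A"
    then have tw: "\<eta>(z := h, w := \<xi> w) = (\<eta>(w := \<xi> w))(z := h)" for h
      using insert(2) by (intro fun_upd_twist) auto
    show "(\<Sum>h\<in>UNIV. \<phi> (\<eta>(z := h, w := \<xi> w)) * of_real (\<kappa> z h)) = \<phi> (\<eta>(z := \<xi> z, w := \<xi> w))"
      unfolding tw using z by (intro insert.prems) simp
  qed
  finally show ?case by simp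
qed simp

lemma sum_UNIV_lamp_factor: "(\<Sum>h\<in>UNIV. of_bool (h = (a::'h::finite)) - 1 / real CARD('h)) = 0"
  by (simp add: sum_subtractf of_bool_def)

text \<open>On an open lamp \<open>f\<close> is constant and averaging returns it; on a closed lamp
  \<open>f\<close> has mean zero, so evaluation minus averaging is evaluation.
  \<open>sum_lamp_factors\<close> combines the lamps.\<close>

lemma sector_kernel_reproducing:
  fixes \<xi> :: "'v \<Rightarrow> 'h::finite"
  assumes fin: "finite (C \<union> D)" "finite W" and CD: "C \<inter> D = {}" and \<xi>: "\<xi> \<in> configs off"
    and f: "f \<in> sector W C D \<xi>" and x: "x \<in> W"
  shows "ell2_inner (lamp_states off) f (sector_kernel C D (\<xi>, x)) = f (\<xi>, x)"
proof -
  let ?A = "agree (C \<union> D) \<xi>"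
  let ?k = "\<lambda>\<eta>. complex_of_real (\<Prod>z\<in>C \<union> D. lamp_factor C \<xi> z (\<eta> z))"
  have "ell2_inner (lamp_states off) f (sector_kernel C D (\<xi>, x))
      = (\<Sum>(\<eta>, y)\<in>?A \<times> W. f (\<eta>, y) * cnj (sector_kernel C D (\<xi>, x) (\<eta>, y)))"
    using fin by (simp add: sector_inner[OF fin(1) \<xi> f] ell2_inner_fin finite_agree case_prod_unfold)
  also have "\<dots> = (\<Sum>\<eta>\<in>?A. \<Sum>y\<in>W. f (\<eta>, y) * cnj (sector_kernel C D (\<xi>, x) (\<eta>, y)))"
    by (rule sum.cartesian_product[symmetric])
  also have "\<dots> = (\<Sum>\<eta>\<in>?A. \<Sum>y\<in>W. if y = x then f (\<eta>, x) * ?k \<eta> else 0)"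
    by (intro sum.cong refl) (auto simp: sector_kernel_def)
  also have "\<dots> = (\<Sum>\<eta>\<in>?A. f (\<eta>, x) * ?k \<eta>)" using fin x by simp
  also have "\<dots> = f (\<xi>, x)"
  proof (rule sum_lamp_factors[OF fin(1), of "\<lambda>\<eta>. f (\<eta>, x)"])
    fix z \<eta> assume z: "z \<in> C \<union> D"
    show "(\<Sum>h\<in>UNIV. f (\<eta>(z := h), x) * of_real (lamp_factor C \<xi> z h)) = f (\<eta>(z := \<xi> z), x)"
    proof (cases "z \<in> C")
      case True
      then show ?thesis by (simp add: sectorD(3)[OF f True] lamp_factor_def)
    next
      case False
      have "(\<Sum>h\<in>UNIV. f (\<eta>(z := h), x) * of_real (lamp_factor C \<xi> z h))
        = (\<Sum>h\<in>UNIV. (if h = \<xi> z then f (\<eta>(z := \<xi> z), x) else 0) - f (\<eta>(z := h), x) / of_nat CARD('h))"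
        using False by (intro sum.cong refl) (auto simp: lamp_factor_def algebra_simps)
      also have "\<dots> = f (\<eta>(z := \<xi> z), x) - (\<Sum>h\<in>UNIV. f (\<eta>(z := h), x)) / of_nat CARD('h)"
        by (simp add: sum_subtractf sum_divide_distrib)
      finally show ?thesis using False z by (simp add: sectorD(4)[OF f])
    qed
  qed
  finally show ?thesis .
qed

text \<open>As a function of the lamp at \<open>z\<close>, the kernel is constant for
  \<open>z\<close> in \<open>C\<close>; for \<open>z\<close> in \<open>D\<close> its only varying
  factor sums to zero.\<close>

lemma sector_kernel_in_sector:
  fixes \<xi> :: "'v \<Rightarrow> 'h::finite"
  assumes fin: "finite (C \<union> D)" and CD: "C \<inter> D = {}" and x: "x \<in> W"
  shows "sector_kernel C D (\<xi>, x) \<in> sector W C D \<xi>"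
  unfolding sector_def mem_Collect_eq
proof (intro conjI allI ballI impI)
  fix \<eta> y assume "sector_kernel C D (\<xi>, x) (\<eta>, y) \<noteq> 0"
  then show "y \<in> W" "\<eta> \<in> agree (C \<union> D) \<xi>" using x by (auto simp: sector_kernel_def split: if_splits)
next
  fix z \<eta> h y assume z: "z \<in> C"
  have "lamp_factor C \<xi> w ((\<eta>(z := h)) w) = lamp_factor C \<xi> w (\<eta> w)" for w
    using z by (auto simp: lamp_factor_def)
  then show "sector_kernel C D (\<xi>, x) (\<eta>(z := h), y) = sector_kernel C D (\<xi>, x) (\<eta>, y)"
    using z by (simp add: sector_kernel_def agree_update)
next
  fix z \<eta> y assume z: "z \<in> D"
  then have zC: "z \<notin> C" using CD by auto
  have pr: "(\<Prod>w\<in>C \<union> D. lamp_factor C \<xi> w ((\<eta>(z := h)) w))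
      = lamp_factor C \<xi> z h * (\<Prod>w\<in>C \<union> D - {z}. lamp_factor C \<xi> w (\<eta> w))" for h
  proof -
    have "(\<Prod>w\<in>C \<union> D - {z}. lamp_factor C \<xi> w ((\<eta>(z := h)) w)) = (\<Prod>w\<in>C \<union> D - {z}. lamp_factor C \<xi> w (\<eta> w))"
      by (intro prod.cong) auto
    then show ?thesis using z fin by (subst prod.remove[of _ z]) auto
  qed
  have "(\<Sum>h\<in>UNIV. lamp_factor C \<xi> z h) = 0"
    using zC by (simp only: lamp_factor_def if_False sum_UNIV_lamp_factor)
  then have "(\<Sum>h\<in>UNIV. \<Prod>w\<in>C \<union> D. lamp_factor C \<xi> w ((\<eta>(z := h)) w)) = 0"
    unfolding pr sum_distrib_right[symmetric] by simp
  then have 0: "(\<Sum>h\<in>UNIV. complex_of_real (\<Prod>w\<in>C \<union> D. lamp_factor C \<xi> w ((\<eta>(z := h)) w))) = 0"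
    by (metis of_real_sum of_real_0)
  show "(\<Sum>h\<in>UNIV. sector_kernel C D (\<xi>, x) (\<eta>(z := h), y)) = 0"
  proof (cases "y = x \<and> \<eta> \<in> agree (C \<union> D) \<xi>")
    case True
    then have "sector_kernel C D (\<xi>, x) (\<eta>(z := h), y) = of_real (\<Prod>w\<in>C \<union> D. lamp_factor C \<xi> w ((\<eta>(z := h)) w))" for h
      using z by (simp only: sector_kernel_def agree_update Un_iff prod.case if_True simp_thms)
    then show ?thesis using 0 by simp
  next
    case False
    then have "sector_kernel C D (\<xi>, x) (\<eta>(z := h), y) = 0" for h
      using z by (auto simp: sector_kernel_def agree_update)
    then show ?thesis by simp
  qed
qed

lemma sector_kernel_diag:
  fixes \<xi> :: "'v \<Rightarrow> 'h::finite"
  assumes fin: "finite (C \<union> D)" and CD: "C \<inter> D = {}"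
  shows "Re (sector_kernel C D (\<xi>, x) (\<xi>, x)) = (1 / real CARD('h)) ^ card C * (1 - 1 / real CARD('h)) ^ card D"
proof -
  have "(\<Prod>z\<in>C \<union> D. lamp_factor C \<xi> z (\<xi> z)) = (\<Prod>z\<in>C. lamp_factor C \<xi> z (\<xi> z)) * (\<Prod>z\<in>D. lamp_factor C \<xi> z (\<xi> z))"
    using fin CD by (intro prod.union_disjoint) auto
  also have "(\<Prod>z\<in>C. lamp_factor C \<xi> z (\<xi> z)) = (\<Prod>z\<in>C. 1 / real CARD('h))"
    by (intro prod.cong) (auto simp: lamp_factor_def)
  also have "(\<Prod>z\<in>D. lamp_factor C \<xi> z (\<xi> z)) = (\<Prod>z\<in>D. 1 - 1 / real CARD('h))"
    using CD by (intro prod.cong) (auto simp: lamp_factor_def)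
  finally show ?thesis by (simp add: sector_kernel_def agree_def)
qed

subsection \<open>The lamplighter operator on sectors\<close>

definition boundary :: "('v \<Rightarrow> 'v \<Rightarrow> bool) \<Rightarrow> 'v set \<Rightarrow> 'v set" where
  "boundary E C = {z. z \<notin> C \<and> (\<exists>y\<in>C. E z y)}"

lemma boundary_disjoint: "C \<inter> boundary E C = {}"
  by (auto simp: boundary_def)

lemma finite_boundary:
  assumes "symp E" "\<And>x. finite {y. E x y}" "finite C"
  shows "finite (boundary E C)"
proof (rule finite_subset)
  show "boundary E C \<subseteq> (\<Union>y\<in>C. {z. E y z})"
    using assms(1) by (auto simp: boundary_def dest: sympD)
qed (use assms in auto)

text \<open>Paths have to stay inside \<open>C\<close>. The empty set counts as connected; as a
  cluster it admits no walker position, so its sector consists of the zero function.\<close>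

definition connected_in :: "('v \<Rightarrow> 'v \<Rightarrow> bool) \<Rightarrow> 'v set \<Rightarrow> bool" where
  "connected_in E C \<longleftrightarrow> (\<forall>x\<in>C. \<forall>y\<in>C. (\<lambda>u v. E u v \<and> u \<in> C \<and> v \<in> C)\<^sup>*\<^sup>* x y)"

text \<open>A path in \<open>C\<close> from \<open>x\<close> to a vertex outside \<open>C'\<close>
  has to leave \<open>C'\<close>, and the vertex it steps onto lies in the boundary of
  \<open>C'\<close>.\<close>

lemma connected_meets_boundary:
  assumes "symp E" "connected_in E C" "x \<in> C" "x \<in> C'" "\<not> C \<subseteq> C'"
  shows "C \<inter> boundary E C' \<noteq> {}"
proof -
  obtain y where y: "y \<in> C" "y \<notin> C'" using assms(5) by blast
  have "(\<lambda>u v. E u v \<and> u \<in> C \<and> v \<in> C)\<^sup>*\<^sup>* x y" using assms(2,3) y by (auto simp: connected_in_def)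
  then have "y \<notin> C' \<longrightarrow> C \<inter> boundary E C' \<noteq> {}"
  proof (induction rule: rtranclp_induct)
    case (step u v)
    then show ?case using sympD[OF assms(1), of u v] by (auto simp: boundary_def)
  qed (use assms(4) in simp)
  then show ?thesis using y by blast
qed

text \<open>Unequal sets fail one of the two inclusions. This single fact yields both the
  orthogonality of cluster sectors and the disjointness of the corresponding percolation
  events.\<close>

lemma distinct_clusters_meet_boundary:
  assumes "symp E" "connected_in E C" "connected_in E C'" "x \<in> C" "x \<in> C'" "C \<noteq> C'"
  shows "C \<inter> boundary E C' \<union> boundary E C \<inter> C' \<noteq> {}"
proof (cases "C \<subseteq> C'")
  case True
  then have "C' \<inter> boundary E C \<noteq> {}"
    using assms by (intro connected_meets_boundary[of E C' x C]) auto
  then show ?thesis by blast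
next
  case False
  then show ?thesis using connected_meets_boundary[OF assms(1,2,4,5)] by blast
qed

text \<open>Testing selfadjointness on the point masses at \<open>x\<close> and \<open>y\<close>
  recovers the matrix entries, which are real.\<close>

lemma transition_op_selfadjoint_imp_symmetric:
  assumes "selfadjoint_on_ell2 UNIV (transition_op UNIV p)"
  shows "p x y = p y x"
proof -
  let ?d = "\<lambda>x t. of_bool (t = x) :: complex"
  have d: "?d x \<in> ell2 UNIV" for x by (intro finite_support_ell2(1)[of "{x}"]) auto
  have sa: "ell2_inner UNIV (transition_op UNIV p f) g = ell2_inner UNIV f (transition_op UNIV p g)"
    if "f \<in> ell2 UNIV" "g \<in> ell2 UNIV" for f g
    using assms that by (simp add: selfadjoint_on_ell2_def)
  have T: "transition_op UNIV p (?d y) = (\<lambda>s. of_real (p s y))" for y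
  proof
    fix s
    have "(\<Sum>\<^sub>\<infinity>t\<in>UNIV. complex_of_real (p s t) * ?d y t) = (\<Sum>\<^sub>\<infinity>t\<in>{y}. complex_of_real (p s t) * ?d y t)"
      by (intro infsum_cong_neutral) auto
    then show "transition_op UNIV p (?d y) s = of_real (p s y)" by (simp add: transition_op_def)
  qed
  have "ell2_inner UNIV (transition_op UNIV p (?d y)) (?d x) = ell2_inner {x} (\<lambda>s. of_real (p s y)) (?d x)"
    unfolding T by (intro ell2_inner_restrict) auto
  moreover have "ell2_inner UNIV (?d y) (transition_op UNIV p (?d x)) = ell2_inner {y} (?d y) (\<lambda>s. of_real (p s x))"
    unfolding T by (intro ell2_inner_restrict) auto
  moreover have "ell2_inner UNIV (transition_op UNIV p (?d y)) (?d x) = ell2_inner UNIV (?d y) (transition_op UNIV p (?d x))"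
    by (rule sa[OF d d])
  ultimately show ?thesis by (simp add: ell2_inner_fin)
qed

text \<open>Local finiteness makes the sum over states finite. As \<open>x\<close> and
  \<open>y\<close> differ, their lamps vary independently, which gives the double sum over
  \<open>k\<close> and \<open>h\<close>.\<close>

lemma lamplighter_op_eq_sum:
  fixes off :: "'h::finite" and \<xi> :: "'v \<Rightarrow> 'h"
  assumes \<xi>: "\<xi> \<in> configs off" and fin: "finite {y. E x y}" and irr: "irreflp E"
  shows "lamplighter_op E p off f (\<xi>, x) = (\<Sum>y | E x y. of_real (p x y / (real CARD('h))\<^sup>2) *
    (\<Sum>k\<in>UNIV. \<Sum>h\<in>UNIV. f (\<xi>(y := k, x := h), y)))"
proof -
  let ?N = "SIGMA y:{y. E x y}. agree {x, y} \<xi>"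
  let ?Z = "(\<lambda>(y, \<eta>). (\<eta>, y)) ` ?N"
  let ?g = "\<lambda>t. complex_of_real (sws_prob E p (\<xi>, x) t) * f t"
  have fN: "finite ?N" using fin by (auto intro: finite_agree)
  have Z: "?Z \<subseteq> lamp_states off"
    using agree_configs[OF _ \<xi>, of "{x, y}" for y] by (auto simp: lamp_states_def)
  have out: "sws_prob E p (\<xi>, x) t = 0" if "t \<notin> ?Z" for t
  proof (cases t)
    case (Pair \<eta> y)
    have "\<not> (E x y \<and> (\<forall>z. z \<notin> {x, y} \<longrightarrow> \<xi> z = \<eta> z))"
    proof
      assume "E x y \<and> (\<forall>z. z \<notin> {x, y} \<longrightarrow> \<xi> z = \<eta> z)"
      then have "(y, \<eta>) \<in> ?N" by (auto simp: agree_def)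
      then show False using that Pair by force
    qed
    then show ?thesis unfolding Pair sws_prob_def by auto
  qed
  have "lamplighter_op E p off f (\<xi>, x) = (\<Sum>\<^sub>\<infinity>t\<in>lamp_states off. ?g t)"
    using \<xi> by (simp add: lamplighter_op_def transition_op_def lamp_states_def)
  also have "\<dots> = (\<Sum>\<^sub>\<infinity>t\<in>?Z. ?g t)"
    using Z out by (intro infsum_cong_neutral) auto
  also have "\<dots> = (\<Sum>t\<in>?Z. ?g t)" using fN by (intro infsum_finite finite_imageI)
  also have "\<dots> = (\<Sum>(y, \<eta>)\<in>?N. ?g (\<eta>, y))"
    by (subst sum.reindex) (auto simp: inj_on_def intro!: sum.cong)
  also have "\<dots> = (\<Sum>y | E x y. \<Sum>\<eta>\<in>agree {x, y} \<xi>. ?g (\<eta>, y))"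
    using fin by (intro sum.Sigma[symmetric]) (auto intro: finite_agree)
  also have "\<dots> = (\<Sum>y | E x y. of_real (p x y / (real CARD('h))\<^sup>2) *
    (\<Sum>k\<in>UNIV. \<Sum>h\<in>UNIV. f (\<xi>(y := k, x := h), y)))"
  proof (intro sum.cong refl)
    fix y assume "y \<in> {y. E x y}"
    then have E: "E x y" and xy: "x \<noteq> y" using irreflpD[OF irr, of x] by auto
    have "(\<Sum>\<eta>\<in>agree {x, y} \<xi>. ?g (\<eta>, y)) = (\<Sum>\<eta>\<in>agree {x, y} \<xi>. of_real (p x y / (real CARD('h))\<^sup>2) * f (\<eta>, y))"
      using E by (intro sum.cong refl) (auto simp: sws_prob_def agree_def)
    also have "\<dots> = of_real (p x y / (real CARD('h))\<^sup>2) * (\<Sum>\<eta>\<in>agree {x, y} \<xi>. f (\<eta>, y))"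
      by (simp only: sum_distrib_left)
    also have "(\<Sum>\<eta>\<in>agree {x, y} \<xi>. f (\<eta>, y)) = (\<Sum>k\<in>UNIV. \<Sum>h\<in>UNIV. f (\<xi>(y := k, x := h), y))"
      using xy sum_agree_insert[of "{y}" x "\<lambda>\<eta>. f (\<eta>, y)" \<xi>]
        sum_agree_insert[of "{}" y "\<lambda>\<eta>. \<Sum>h\<in>UNIV. f (\<eta>(x := h), y)" \<xi>] by simp
    finally show "(\<Sum>\<eta>\<in>agree {x, y} \<xi>. ?g (\<eta>, y)) = of_real (p x y / (real CARD('h))\<^sup>2) *
      (\<Sum>k\<in>UNIV. \<Sum>h\<in>UNIV. f (\<xi>(y := k, x := h), y))" .
  qed
  finally show ?thesis .
qed

lemma lamplighter_op_outside: "\<xi> \<notin> configs off \<Longrightarrow> lamplighter_op E p off f (\<xi>, x) = 0"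
  by (simp add: lamplighter_op_def transition_op_def lamp_states_def)

lemma sector_outside_configs:
  "finite (C \<union> D) \<Longrightarrow> \<zeta> \<in> configs off \<Longrightarrow> f \<in> sector W C D \<zeta> \<Longrightarrow> \<xi> \<notin> configs off \<Longrightarrow> f (\<xi>, x) = 0"
  using agree_configs[of "C \<union> D" \<zeta> off] by (intro sectorD(2)) auto

text \<open>Local finiteness turns each value of the operator into a finite sum, so this is an
  interchange of sums.\<close>

lemma lamplighter_op_sum:
  fixes B :: "(('v \<Rightarrow> 'h::finite) \<times> 'v \<Rightarrow> complex) set"
  assumes fin: "\<And>x. finite {y. E x y}" and irr: "irreflp E"
  shows "lamplighter_op E p off (\<lambda>s. \<Sum>b\<in>B. c b * b s) = (\<lambda>s. \<Sum>b\<in>B. c b * lamplighter_op E p off b s)"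
proof
  fix s :: "('v \<Rightarrow> 'h) \<times> 'v"
  obtain \<xi> x where s: "s = (\<xi>, x)" by (cases s)
  show "lamplighter_op E p off (\<lambda>s. \<Sum>b\<in>B. c b * b s) s = (\<Sum>b\<in>B. c b * lamplighter_op E p off b s)"
  proof (cases "\<xi> \<in> configs off")
    case True
    let ?a = "\<lambda>y. complex_of_real (p x y / (real CARD('h))\<^sup>2)"
    have "lamplighter_op E p off (\<lambda>s. \<Sum>b\<in>B. c b * b s) s
      = (\<Sum>y | E x y. ?a y * (\<Sum>k\<in>UNIV. \<Sum>h\<in>UNIV. \<Sum>b\<in>B. c b * b (\<xi>(y := k, x := h), y)))"
      unfolding s by (rule lamplighter_op_eq_sum[OF True fin irr])
    also have "\<dots> = (\<Sum>y | E x y. \<Sum>b\<in>B. c b * (?a y * (\<Sum>k\<in>UNIV. \<Sum>h\<in>UNIV. b (\<xi>(y := k, x := h), y))))"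
    proof (intro sum.cong refl)
      fix y
      have "(\<Sum>k\<in>UNIV. \<Sum>h\<in>UNIV. \<Sum>b\<in>B. c b * b (\<xi>(y := k, x := h), y))
        = (\<Sum>k\<in>UNIV. \<Sum>b\<in>B. \<Sum>h\<in>UNIV. c b * b (\<xi>(y := k, x := h), y))"
        by (intro sum.cong refl sum.swap)
      also have "\<dots> = (\<Sum>b\<in>B. \<Sum>k\<in>UNIV. \<Sum>h\<in>UNIV. c b * b (\<xi>(y := k, x := h), y))"
        by (rule sum.swap)
      finally show "?a y * (\<Sum>k\<in>UNIV. \<Sum>h\<in>UNIV. \<Sum>b\<in>B. c b * b (\<xi>(y := k, x := h), y))
        = (\<Sum>b\<in>B. c b * (?a y * (\<Sum>k\<in>UNIV. \<Sum>h\<in>UNIV. b (\<xi>(y := k, x := h), y))))"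
        by (simp only: sum_distrib_left mult.left_commute)
    qed
    also have "\<dots> = (\<Sum>b\<in>B. c b * lamplighter_op E p off b s)"
      unfolding s lamplighter_op_eq_sum[OF True fin irr] sum_distrib_left by (rule sum.swap)
    finally show ?thesis .
  qed (simp add: s lamplighter_op_outside)
qed

text \<open>A cluster sector is invariant because a step from \<open>C\<close> to its boundary is killed by averaging
  over a balanced lamp; on it the operator acts as the walk killed outside \<open>C\<close>.\<close>

lemma lamplighter_op_cluster:
  fixes off :: "'h::finite" and \<zeta> :: "'v \<Rightarrow> 'h"
  assumes fin: "\<And>x. finite {y. E x y}" and E: "symp E" "irreflp E"
    and p: "\<And>x y. \<not> E x y \<Longrightarrow> p x y = 0"
    and C: "finite C" and \<zeta>: "\<zeta> \<in> configs off"
    and f: "f \<in> sector C C (boundary E C) \<zeta>"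
  shows "lamplighter_op E p off f (\<xi>, x) = (if x \<in> C then \<Sum>y\<in>C. of_real (p x y) * f (\<xi>, y) else 0)"
proof (cases "\<xi> \<in> configs off")
  case True
  let ?m = "complex_of_nat CARD('h)"
  have trm: "of_real (p x y / (real CARD('h))\<^sup>2) * (\<Sum>k\<in>UNIV. \<Sum>h\<in>UNIV. f (\<xi>(y := k, x := h), y))
    = (if x \<in> C \<and> y \<in> C then of_real (p x y) * f (\<xi>, y) else 0)" if xy: "E x y" for y
  proof (cases "y \<in> C")
    case y: True
    have ne: "y \<noteq> x" using xy irreflpD[OF E(2), of x] by auto
    have "(\<Sum>k\<in>UNIV. \<Sum>h\<in>UNIV. f (\<xi>(y := k, x := h), y)) = ?m * (\<Sum>h\<in>UNIV. f (\<xi>(x := h), y))"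
      by (simp add: fun_upd_twist[OF ne] sectorD(3)[OF f y])
    \<comment> \<open>The lamps at \<open>y\<close> and \<open>x\<close>, if both open, contribute
      one factor \<open>?m\<close> each; these cancel the normalisation of
      \<open>sws_prob\<close>.\<close>
    also have "\<dots> = (if x \<in> C then ?m * ?m * f (\<xi>, y) else 0)"
    proof (cases "x \<in> C")
      case False
      then have "x \<in> boundary E C" using xy y by (auto simp: boundary_def)
      then show ?thesis using False by (simp add: sectorD(4)[OF f])
    qed (simp add: sectorD(3)[OF f])
    finally show ?thesis using y by (simp add: power2_eq_square)
  qed (simp add: sectorD(1)[OF f])
  have "lamplighter_op E p off f (\<xi>, x)
    = (\<Sum>y | E x y. if x \<in> C \<and> y \<in> C then of_real (p x y) * f (\<xi>, y) else 0)"
    unfolding lamplighter_op_eq_sum[OF True fin E(2)] by (intro sum.cong refl trm) simp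
  also have "\<dots> = (if x \<in> C then \<Sum>y\<in>C. of_real (p x y) * f (\<xi>, y) else 0)"
  proof (cases "x \<in> C")
    case True
    have "(\<Sum>y | E x y. if y \<in> C then of_real (p x y) * f (\<xi>, y) else 0) = (\<Sum>y\<in>{y. E x y} \<inter> C. of_real (p x y) * f (\<xi>, y))"
      using fin by (simp add: sum.inter_restrict)
    also have "\<dots> = (\<Sum>y\<in>C. of_real (p x y) * f (\<xi>, y))"
      using C p by (intro sum.mono_neutral_left) auto
    finally show ?thesis using True by simp
  qed simp
  finally show ?thesis .
next
  case False
  have "f (\<xi>, y) = 0" for y
    using finite_boundary[OF E(1) fin C] C by (intro sector_outside_configs[OF _ \<zeta> f False]) auto
  then show ?thesis using False by (simp add: lamplighter_op_outside)
qed

text \<open>Only a step to \<open>a\<close> could contribute, and the walk averages over the lamp at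
  the vertex it reaches, where \<open>f\<close> is balanced.\<close>

lemma lamplighter_op_closed:
  fixes off :: "'h::finite" and \<zeta> :: "'v \<Rightarrow> 'h"
  assumes fin: "\<And>x. finite {y. E x y}" and E: "irreflp E"
    and f: "f \<in> sector {a} {} {a} \<zeta>"
  shows "lamplighter_op E p off f (\<xi>, x) = 0"
proof (cases "\<xi> \<in> configs off")
  case True
  have "(\<Sum>k\<in>UNIV. \<Sum>h\<in>UNIV. f (\<xi>(y := k, x := h), y)) = 0" if xy: "E x y" for y
  proof (cases "y = a")
    case True
    have ne: "y \<noteq> x" using xy irreflpD[OF E, of x] by auto
    have "(\<Sum>k\<in>UNIV. \<Sum>h\<in>UNIV. f (\<xi>(y := k, x := h), y)) = (\<Sum>h\<in>UNIV. \<Sum>k\<in>UNIV. f (\<xi>(x := h, y := k), y))"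
      by (subst sum.swap) (simp add: fun_upd_twist[OF ne])
    also have "\<dots> = 0" using True by (simp add: sectorD(4)[OF f])
    finally show ?thesis .
  qed (simp add: sectorD(1)[OF f])
  then show ?thesis unfolding lamplighter_op_eq_sum[OF True fin E] by (intro sum.neutral) simp
qed (simp add: lamplighter_op_outside)

text \<open>The second alternative is a walker at a closed vertex; there the operator vanishes.\<close>

definition percolation_pattern :: "('v \<Rightarrow> 'v \<Rightarrow> bool) \<Rightarrow> 'v set \<times> 'v set \<times> 'v set \<Rightarrow> bool" where
  "percolation_pattern E = (\<lambda>(W, C, D). (finite C \<and> connected_in E C \<and> W = C \<and> D = boundary E C)
     \<or> (\<exists>a. W = {a} \<and> C = {} \<and> D = {a}))"

lemma percolation_pattern_finite:
  assumes "symp E" "\<And>x. finite {y. E x y}" "percolation_pattern E (W, C, D)"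
  shows "finite W" "finite (C \<union> D)" "C \<inter> D = {}"
proof -
  have "finite W \<and> finite (C \<union> D) \<and> C \<inter> D = {}"
    using assms(3) unfolding percolation_pattern_def prod.case
  proof
    assume C: "finite C \<and> connected_in E C \<and> W = C \<and> D = boundary E C"
    then have "finite D" using finite_boundary[of E C] assms(1,2) by simp
    then show ?thesis using C boundary_disjoint[of C E] by simp
  qed auto
  then show "finite W" "finite (C \<union> D)" "C \<inter> D = {}" by simp_all
qed

text \<open>Two clusters meet each other's boundary; a cluster containing \<open>a\<close> clashes
  with a closed walker at \<open>a\<close> in the lamp of \<open>a\<close>; two closed patterns with
  a common walker position coincide.\<close>

lemma percolation_pattern_distinct:
  assumes "symp E" "percolation_pattern E (W, C, D)" "percolation_pattern E (W', C', D')"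
    and "(W, C, D) \<noteq> (W', C', D')" "W \<inter> W' \<noteq> {}"
  shows "C \<inter> D' \<union> D \<inter> C' \<noteq> {}"
proof -
  obtain x where x: "x \<in> W" "x \<in> W'" using assms(5) by blast
  have "C \<inter> D' \<union> D \<inter> C' \<noteq> {}"
    if "connected_in E C" "W = C" "D = boundary E C" "connected_in E C'" "W' = C'" "D' = boundary E C'"
    using distinct_clusters_meet_boundary[OF assms(1) that(1,4)] x that assms(4) by auto
  then show ?thesis using assms(2-4) x unfolding percolation_pattern_def by auto
qed

text \<open>The killed walk changes only the walker's position, so the conditions on the lamps pass
  to the image; for a closed walker the image is zero.\<close>

lemma lamplighter_op_sector_invariant:
  fixes off :: "'h::finite" and \<zeta> :: "'v \<Rightarrow> 'h"
  assumes fin: "\<And>x. finite {y. E x y}" and E: "symp E" "irreflp E"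
    and p: "\<And>x y. \<not> E x y \<Longrightarrow> p x y = 0"
    and \<zeta>: "\<zeta> \<in> configs off" and P: "percolation_pattern E (W, C, D)"
    and f: "f \<in> sector W C D \<zeta>"
  shows "lamplighter_op E p off f \<in> sector W C D \<zeta>"
  using P unfolding percolation_pattern_def prod.case
proof
  assume C: "finite C \<and> connected_in E C \<and> W = C \<and> D = boundary E C"
  then have f': "f \<in> sector C C (boundary E C) \<zeta>" using f by simp
  have T: "lamplighter_op E p off f (\<xi>, x) = (if x \<in> C then \<Sum>y\<in>C. of_real (p x y) * f (\<xi>, y) else 0)" for \<xi> x
    using C by (intro lamplighter_op_cluster[OF fin E p _ \<zeta> f']) auto
  have "lamplighter_op E p off f \<in> sector C C (boundary E C) \<zeta>"
    unfolding sector_def mem_Collect_eq T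
  proof (intro conjI allI ballI impI)
    fix \<eta> x assume *: "(if x \<in> C then \<Sum>y\<in>C. of_real (p x y) * f (\<eta>, y) else 0) \<noteq> 0"
    then show "x \<in> C" by (auto split: if_splits)
    show "\<eta> \<in> agree (C \<union> boundary E C) \<zeta>"
    proof (rule ccontr)
      assume "\<eta> \<notin> agree (C \<union> boundary E C) \<zeta>"
      then have "f (\<eta>, y) = 0" for y by (rule sectorD(2)[OF f'])
      then show False using * by (auto split: if_splits)
    qed
  next
    fix z \<eta> x assume z: "z \<in> boundary E C"
    have "(\<Sum>h\<in>UNIV. \<Sum>y\<in>C. of_real (p x y) * f (\<eta>(z := h), y)) = (\<Sum>y\<in>C. of_real (p x y) * (\<Sum>h\<in>UNIV. f (\<eta>(z := h), y)))"
      by (subst sum.swap) (simp add: sum_distrib_left)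
    also have "\<dots> = 0" by (simp add: sectorD(4)[OF f' z])
    finally show "(\<Sum>h\<in>UNIV. if x \<in> C then \<Sum>y\<in>C. of_real (p x y) * f (\<eta>(z := h), y) else 0) = 0"
      by (cases "x \<in> C") simp_all
  qed (simp add: sectorD(3)[OF f'])
  then show ?thesis using C by simp
next
  assume "\<exists>a. W = {a} \<and> C = {} \<and> D = {a}"
  then obtain a where "W = {a}" "C = {}" "D = {a}" by blast
  then have "lamplighter_op E p off f (\<xi>, x) = 0" for \<xi> x
    using f by (intro lamplighter_op_closed[OF fin E(2)]) auto
  then have "lamplighter_op E p off f = (\<lambda>_. 0)" by (intro ext) (metis surj_pair)
  then show ?thesis using fun_subspace_sector[of W C D \<zeta>] by (simp add: fun_subspace_def)
qed

text \<open>For each fixed configuration the operator acts on the cluster as the real symmetric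
  matrix \<open>p\<close> restricted to \<open>C\<close>.\<close>

lemma lamplighter_op_sector_symmetric:
  fixes off :: "'h::finite" and \<zeta> :: "'v \<Rightarrow> 'h"
  assumes fin: "\<And>x. finite {y. E x y}" and E: "symp E" "irreflp E"
    and p: "\<And>x y. \<not> E x y \<Longrightarrow> p x y = 0" "\<And>x y. p x y = p y x"
    and \<zeta>: "\<zeta> \<in> configs off" and P: "percolation_pattern E (W, C, D)"
    and f: "f \<in> sector W C D \<zeta>" and g: "g \<in> sector W C D \<zeta>"
  shows "ell2_inner (lamp_states off) (lamplighter_op E p off f) g
    = ell2_inner (lamp_states off) f (lamplighter_op E p off g)"
  using P unfolding percolation_pattern_def prod.case
proof
  assume C: "finite C \<and> connected_in E C \<and> W = C \<and> D = boundary E C"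
  let ?A = "agree (C \<union> D) \<zeta>"
  note fins = percolation_pattern_finite[OF E(1) fin P]
  have T: "lamplighter_op E p off f (\<xi>, x) = (if x \<in> C then \<Sum>y\<in>C. of_real (p x y) * f (\<xi>, y) else 0)"
    if "f \<in> sector W C D \<zeta>" for f \<xi> x
    using C that by (intro lamplighter_op_cluster[OF fin E p(1) _ \<zeta>]) auto
  have "ell2_inner (lamp_states off) (lamplighter_op E p off f) g
      = (\<Sum>s\<in>?A \<times> C. lamplighter_op E p off f s * cnj (g s))"
    using fins C sector_inner[OF fins(2) \<zeta> lamplighter_op_sector_invariant[OF fin E p(1) \<zeta> P f], where g = g]
    by (simp add: ell2_inner_fin finite_agree)
  also have "\<dots> = (\<Sum>\<xi>\<in>?A. \<Sum>x\<in>C. lamplighter_op E p off f (\<xi>, x) * cnj (g (\<xi>, x)))"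
    by (simp add: sum.cartesian_product)
  also have "\<dots> = (\<Sum>\<xi>\<in>?A. \<Sum>x\<in>C. \<Sum>y\<in>C. of_real (p x y) * f (\<xi>, y) * cnj (g (\<xi>, x)))"
    by (intro sum.cong refl) (simp add: T[OF f] sum_distrib_right)
  also have "\<dots> = (\<Sum>\<xi>\<in>?A. \<Sum>y\<in>C. \<Sum>x\<in>C. of_real (p x y) * f (\<xi>, y) * cnj (g (\<xi>, x)))"
    by (intro sum.cong refl sum.swap)
  also have "\<dots> = (\<Sum>\<xi>\<in>?A. \<Sum>y\<in>C. f (\<xi>, y) * cnj (lamplighter_op E p off g (\<xi>, y)))"
    by (intro sum.cong refl) (simp add: T[OF g] sum_distrib_left p(2)[of _ y for y] mult_ac)
  also have "\<dots> = (\<Sum>s\<in>?A \<times> C. f s * cnj (lamplighter_op E p off g s))"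
    by (simp add: sum.cartesian_product)
  also have "\<dots> = ell2_inner (lamp_states off) f (lamplighter_op E p off g)"
    using fins C sector_inner[OF fins(2) \<zeta> f] by (simp add: ell2_inner_fin finite_agree)
  finally show ?thesis .
next
  assume "\<exists>a. W = {a} \<and> C = {} \<and> D = {a}"
  then obtain a where a: "W = {a}" "C = {}" "D = {a}" by blast
  then have "lamplighter_op E p off f s = 0" if "f \<in> sector W C D \<zeta>" for f s
    using that by (cases s) (auto intro: lamplighter_op_closed[OF fin E(2)])
  then show ?thesis using f g by (simp add: ell2_inner_def)
qed

subsection \<open>Subcritical percolation\<close>

lemma prob_space_site_percolation: "prob_space (site_percolation q)"
  unfolding site_percolation_def by (intro prob_space_PiM prob_space_measure_pmf)

lemma product_prob_space_pmf: "product_prob_space (\<lambda>_. measure_pmf \<mu>)"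
  by (simp add: product_prob_space_def product_prob_space_axioms_def product_sigma_finite_def
      prob_space_measure_pmf prob_space_imp_sigma_finite)

lemma space_site_percolation [simp]: "space (site_percolation q) = UNIV"
  by (simp add: site_percolation_def space_PiM PiE_UNIV_domain)

lemma measurable_site [measurable]: "(\<lambda>\<omega>. \<omega> z) \<in> measurable (site_percolation q) (count_space UNIV)"
proof -
  have "(\<lambda>\<omega>. \<omega> z) \<in> measurable (site_percolation q) (measure_pmf (bernoulli_pmf q))"
    unfolding site_percolation_def by measurable
  then show ?thesis by simp
qed

section \<open>Cylinder events and product measures\<close>

definition cylinder :: "'v set \<Rightarrow> 'v set \<Rightarrow> ('v \<Rightarrow> bool) set" where
  "cylinder A B = {\<omega>. (\<forall>z\<in>A. \<omega> z) \<and> (\<forall>z\<in>B. \<not> \<omega> z)}"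

lemma sets_cylinder:
  assumes "finite A" "finite B" shows "cylinder A B \<in> sets (site_percolation q)"
proof -
  have "{\<omega> \<in> space (site_percolation q). (\<forall>z\<in>A. \<omega> z) \<and> (\<forall>z\<in>B. \<not> \<omega> z)} \<in> sets (site_percolation q)"
    using assms by measurable
  then show ?thesis by (simp add: cylinder_def)
qed

lemma measure_cylinder:
  assumes "finite A" "finite B" "A \<inter> B = {}" and q: "0 \<le> q" "q \<le> 1"
  shows "measure (site_percolation q) (cylinder A B) = q ^ card A * (1 - q) ^ card B"
proof -
  interpret product_prob_space "\<lambda>_::'a. measure_pmf (bernoulli_pmf q)" UNIV
    by (rule product_prob_space_pmf)
  let ?F = "\<lambda>z. {z \<in> A}"
  have "cylinder A B = {\<omega> \<in> space (\<Pi>\<^sub>M x\<in>UNIV. measure_pmf (bernoulli_pmf q)). \<forall>z\<in>A \<union> B. \<omega> z \<in> ?F z}"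
    using assms(3) by (auto simp: cylinder_def space_PiM PiE_UNIV_domain)
  then have "emeasure (site_percolation q) (cylinder A B) = (\<Prod>z\<in>A \<union> B. emeasure (measure_pmf (bernoulli_pmf q)) (?F z))"
    unfolding site_percolation_def using assms by (subst emeasure_PiM_Collect[symmetric]) auto
  also have "\<dots> = (\<Prod>z\<in>A \<union> B. ennreal (if z \<in> A then q else 1 - q))"
    using q assms(3) by (intro prod.cong refl) (auto simp: emeasure_pmf_single)
  also have "\<dots> = ennreal (\<Prod>z\<in>A \<union> B. if z \<in> A then q else 1 - q)"
    using q by (intro prod_ennreal) auto
  also have "(\<Prod>z\<in>A \<union> B. if z \<in> A then q else 1 - q) = (\<Prod>z\<in>A. if z \<in> A then q else 1 - q) * (\<Prod>z\<in>B. if z \<in> A then q else 1 - q)"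
    using assms by (intro prod.union_disjoint)
  also have "(\<Prod>z\<in>A. if z \<in> A then q else 1 - q) = (\<Prod>z\<in>A. q)"
    by (intro prod.cong) auto
  also have "(\<Prod>z\<in>B. if z \<in> A then q else 1 - q) = (\<Prod>z\<in>B. 1 - q)"
    using assms(3) by (intro prod.cong) auto
  finally show ?thesis using q by (simp add: measure_def)
qed

text \<open>Product measures are determined by finite-dimensional boxes, and the preimage of a box
  under a coordinatewise map is a box. This reads off the marginals of the coupling.\<close>

lemma distr_PiM_map_pmf:
  "distr (\<Pi>\<^sub>M x\<in>UNIV. measure_pmf \<mu>) (\<Pi>\<^sub>M x\<in>UNIV. measure_pmf (map_pmf g \<mu>)) (\<lambda>\<omega> x. g (\<omega> x))
    = (\<Pi>\<^sub>M x\<in>(UNIV :: 'v set). measure_pmf (map_pmf g \<mu>))"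
    (is "distr ?M ?N ?g = _")
  and measurable_PiM_map_pmf:
  "(\<lambda>\<omega> x. g (\<omega> x)) \<in> measurable (\<Pi>\<^sub>M x\<in>UNIV. measure_pmf \<mu>) (\<Pi>\<^sub>M x\<in>(UNIV :: 'v set). measure_pmf (map_pmf g \<mu>))"
proof -
  interpret P: product_prob_space "\<lambda>_::'v. measure_pmf \<mu>" UNIV by (rule product_prob_space_pmf)
  interpret Q: product_prob_space "\<lambda>_::'v. measure_pmf (map_pmf g \<mu>)" UNIV by (rule product_prob_space_pmf)
  have "(\<lambda>\<omega>. g (\<omega> x)) \<in> measurable ?M (measure_pmf (map_pmf g \<mu>))" for x
    by (rule measurable_compose[OF measurable_component_singleton[of x]]) auto
  then have "(\<lambda>\<omega>. \<lambda>x\<in>UNIV. g (\<omega> x)) \<in> measurable ?M ?N" by (intro measurable_restrict)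
  then show meas: "?g \<in> measurable ?M ?N" by (simp add: restrict_def)
  show "distr ?M ?N ?g = ?N"
  proof (rule Q.PiM_eq)
    fix J :: "'v set" and F assume J: "finite J"
    have "prod_emb UNIV (\<lambda>_. measure_pmf (map_pmf g \<mu>)) J (Pi\<^sub>E J F) = {\<omega> \<in> space ?N. \<forall>x\<in>J. \<omega> x \<in> F x}"
      by (auto simp: prod_emb_def space_PiM PiE_UNIV_domain PiE_iff)
    moreover have "prod_emb UNIV (\<lambda>_. measure_pmf (map_pmf g \<mu>)) J (Pi\<^sub>E J F) \<in> sets ?N"
      using J by (intro sets_PiM_I) auto
    ultimately have "emeasure (distr ?M ?N ?g) (prod_emb UNIV (\<lambda>_. measure_pmf (map_pmf g \<mu>)) J (Pi\<^sub>E J F))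
        = emeasure ?M (?g -` {\<omega> \<in> space ?N. \<forall>x\<in>J. \<omega> x \<in> F x} \<inter> space ?M)"
      using meas by (simp add: emeasure_distr)
    also have "?g -` {\<omega> \<in> space ?N. \<forall>x\<in>J. \<omega> x \<in> F x} \<inter> space ?M = {\<omega> \<in> space ?M. \<forall>x\<in>J. \<omega> x \<in> g -` F x}"
      by (auto simp: space_PiM PiE_UNIV_domain)
    also have "emeasure ?M \<dots> = (\<Prod>x\<in>J. emeasure (measure_pmf \<mu>) (g -` F x))"
      using J by (intro P.emeasure_PiM_Collect) auto
    finally show "emeasure (distr ?M ?N ?g) (prod_emb UNIV (\<lambda>_. measure_pmf (map_pmf g \<mu>)) J (Pi\<^sub>E J F))
        = (\<Prod>x\<in>J. emeasure (measure_pmf (map_pmf g \<mu>)) (F x))" by simp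
  qed simp
qed

text \<open>The hypothesis is not assumed to be a measurable event; the coupling needs measurability only
  at the smaller parameter.\<close>

lemma site_percolation_coupling:
  assumes r: "0 \<le> r" "r \<le> q" "0 < q" "q \<le> 1"
    and P: "AE \<omega> in site_percolation q. P \<omega>"
    and PQ: "\<And>\<omega> \<omega>'. P \<omega> \<Longrightarrow> (\<And>z. \<omega>' z \<Longrightarrow> \<omega> z) \<Longrightarrow> Q \<omega>'"
    and Q: "{\<omega>. Q \<omega>} \<in> sets (site_percolation r)"
  shows "AE \<omega> in site_percolation r. Q \<omega>"
proof -
  \<comment> \<open>Thinning: a site open at parameter \<open>q\<close> stays open with probability
    \<open>r / q\<close>. The first component has parameter \<open>q\<close>, the conjunction has
    parameter \<open>q * (r / q) = r\<close>.\<close>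
  define \<mu> where "\<mu> = pair_pmf (bernoulli_pmf q) (bernoulli_pmf (r / q))"
  let ?M = "\<Pi>\<^sub>M x\<in>UNIV. measure_pmf \<mu>"
  let ?and = "\<lambda>(a, b). a \<and> b"
  have rq: "0 \<le> r / q" "r / q \<le> 1" using r by (auto simp: field_simps)
  have "?and -` {True} = {(True, True)}" by auto
  then have "pmf (map_pmf ?and \<mu>) True = r"
    using r rq by (simp add: \<mu>_def pmf_map measure_pmf_single pmf_pair)
  then have and_eq: "map_pmf ?and \<mu> = bernoulli_pmf r"
    using r by (intro pmf_eqI) (metis (full_types) pmf_False_conv_True pmf_bernoulli_True order_trans)
  have fst_eq: "map_pmf fst \<mu> = bernoulli_pmf q" by (simp add: \<mu>_def map_fst_pair_pmf)
  note [simp] = fst_eq and_eq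
  have "AE \<omega> in distr ?M (\<Pi>\<^sub>M x\<in>UNIV. measure_pmf (map_pmf fst \<mu>)) (\<lambda>\<omega> x. fst (\<omega> x)). P \<omega>"
    using P[unfolded site_percolation_def] unfolding distr_PiM_map_pmf unfolding fst_eq .
  then have "AE \<omega> in ?M. P (\<lambda>x. fst (\<omega> x))"
    by (rule AE_distrD[OF measurable_PiM_map_pmf])
  then have "AE \<omega> in ?M. Q (\<lambda>x. ?and (\<omega> x))"
    by (rule AE_mp) (intro AE_I2 impI, erule PQ, auto)
  moreover have "{\<omega> \<in> space (\<Pi>\<^sub>M x\<in>UNIV. measure_pmf (map_pmf ?and \<mu>)). Q \<omega>} \<in> sets (\<Pi>\<^sub>M x\<in>UNIV. measure_pmf (map_pmf ?and \<mu>))"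
    using Q by (simp add: site_percolation_def space_PiM PiE_UNIV_domain)
  ultimately have "AE \<omega> in distr ?M (\<Pi>\<^sub>M x\<in>UNIV. measure_pmf (map_pmf ?and \<mu>)) (\<lambda>\<omega> x. ?and (\<omega> x)). Q \<omega>"
    by (subst AE_distr_iff[OF measurable_PiM_map_pmf]) auto
  then show ?thesis unfolding distr_PiM_map_pmf unfolding and_eq site_percolation_def .
qed

text \<open>Among infinitely many neighbours of \<open>x\<close>, infinitely many are open almost
  surely, and an open \<open>x\<close> would have them all in its cluster. So \<open>x\<close> would
  be closed almost surely, against \<open>q > 0\<close>.\<close>

lemma locally_finite_if_finite_clusters:
  assumes q: "0 < q" "q \<le> 1"
    and fin: "AE \<omega> in site_percolation q. finite (open_cluster E \<omega> x)"
  shows "finite {y. E x y}"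
proof (rule ccontr)
  assume "infinite {y. E x y}"
  then obtain s :: "nat \<Rightarrow> _" where s: "inj s" "range s \<subseteq> {y. E x y}"
    using infinite_countable_subset by blast
  let ?M = "site_percolation q"
  interpret prob_space ?M by (rule prob_space_site_percolation)
  have "AE \<omega> in ?M. \<exists>n\<ge>j. \<omega> (s n)" for j
  proof -
    \<comment> \<open>The event that all neighbours \<open>s n\<close> with \<open>n \<ge> j\<close>
      are closed; injectivity of \<open>s\<close> makes the first \<open>k\<close> of them distinct
      sites, hence the bound \<open>(1 - q) ^ k\<close>.\<close>
    let ?A = "\<Inter>k. cylinder {} (s ` {j..<j + k})"
    have "UNIV \<in> sets ?M" using sets.top[of ?M] by simp
    then have sets: "?A \<in> sets ?M" by (intro sets.countable_INT'' sets_cylinder) auto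
    have "measure ?M ?A \<le> (1 - q) ^ k" for k
    proof -
      have "measure ?M ?A \<le> measure ?M (cylinder {} (s ` {j..<j + k}))"
        by (intro finite_measure_mono sets_cylinder) auto
      also have "\<dots> = (1 - q) ^ k"
        using q s(1) by (subst measure_cylinder) (auto simp: card_image inj_on_subset)
      finally show ?thesis .
    qed
    moreover have "(\<lambda>k. (1 - q) ^ k) \<longlonglongrightarrow> 0" using q by (intro LIMSEQ_power_zero) auto
    ultimately have "measure ?M ?A \<le> 0" by (intro LIMSEQ_le_const) auto
    then have "?A \<in> null_sets ?M"
      using sets measure_nonneg[of ?M ?A] by (auto simp: emeasure_eq_measure)
    then have "AE \<omega> in ?M. \<omega> \<notin> ?A" by (rule AE_not_in)
    then show ?thesis
    proof (rule AE_mp, intro AE_I2 impI)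
      fix \<omega> assume "\<omega> \<notin> ?A"
      then show "\<exists>n\<ge>j. \<omega> (s n)" by (auto simp: cylinder_def)
    qed
  qed
  then have "AE \<omega> in ?M. \<forall>j. \<exists>n\<ge>j. \<omega> (s n)" by (simp add: AE_all_countable)
  with fin have "AE \<omega> in ?M. \<not> \<omega> x"
  proof eventually_elim
    case (elim \<omega>)
    show ?case
    proof
      assume "\<omega> x"
      then have "s ` {n. \<omega> (s n)} \<subseteq> open_cluster E \<omega> x"
        using s(2) by (auto simp: open_cluster_def intro!: r_into_rtranclp)
      then have "finite {n. \<omega> (s n)}"
        using elim(1) s(1) by (meson finite_imageD finite_subset inj_on_subset subset_UNIV)
      then show False using elim(2) infinite_nat_iff_unbounded_le by blast
    qed
  qed
  then have "AE \<omega> in ?M. \<omega> \<notin> cylinder {x} {}" by (simp add: cylinder_def)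
  then have "measure ?M (cylinder {x} {}) = 0"
    by (subst (asm) AE_iff_measurable[OF sets_cylinder[of "{x}" "{}"]]) (auto simp: measure_def)
  then show False using q by (simp add: measure_cylinder)
qed

text \<open>All vertices of an open path from \<open>x\<close> lie in the cluster, so the path stays
  inside it; an open boundary vertex would prolong such a path.\<close>

lemma open_cluster_connected:
  assumes "symp E" "\<omega> x"
  shows "x \<in> open_cluster E \<omega> x" "connected_in E (open_cluster E \<omega> x)"
    "\<omega> \<in> cylinder (open_cluster E \<omega> x) (boundary E (open_cluster E \<omega> x))"
proof -
  let ?C = "open_cluster E \<omega> x"
  let ?R = "\<lambda>u v. E u v \<and> \<omega> u \<and> \<omega> v" and ?S = "\<lambda>u v. E u v \<and> u \<in> ?C \<and> v \<in> ?C"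
  show x: "x \<in> ?C" using assms(2) by (simp add: open_cluster_def)
  have path: "?S\<^sup>*\<^sup>* x y" if "y \<in> ?C" for y
  proof -
    have "?R\<^sup>*\<^sup>* x y" using that by (simp add: open_cluster_def)
    then show ?thesis
    proof (induction rule: rtranclp_induct)
      case (step u v)
      have "u \<in> ?C" "v \<in> ?C"
        using step(1,2) assms(2) by (auto simp: open_cluster_def intro: rtranclp.rtrancl_into_rtrancl)
      then show ?case using step by (auto intro: rtranclp.rtrancl_into_rtrancl)
    qed simp
  qed
  have "symp ?S" using assms(1) by (auto simp: symp_def)
  then have "symp ?S\<^sup>*\<^sup>*" by (rule symp_rtranclp)
  then show "connected_in E ?C"
    unfolding connected_in_def using path by (meson rtranclp_trans sympD)
  have op: "\<omega> y" if "y \<in> ?C" for y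
  proof -
    have "?R\<^sup>*\<^sup>* x y" using that by (simp add: open_cluster_def)
    then show ?thesis using assms(2) by (cases rule: rtranclp.cases) auto
  qed
  have "\<not> \<omega> z" if z: "z \<in> boundary E ?C" for z
  proof
    assume "\<omega> z"
    obtain y where y: "y \<in> ?C" "E z y" using z by (auto simp: boundary_def)
    then have "?R\<^sup>*\<^sup>* x z"
      using op[OF y(1)] \<open>\<omega> z\<close> sympD[OF assms(1) y(2)]
      by (auto simp: open_cluster_def intro: rtranclp.rtrancl_into_rtrancl)
    then show False using z assms(2) by (simp add: boundary_def open_cluster_def)
  qed
  then show "\<omega> \<in> cylinder ?C (boundary E ?C)" using op by (simp add: cylinder_def)
qed

lemma open_cluster_mono:
  assumes "\<And>z. \<omega>' z \<Longrightarrow> \<omega> z" shows "open_cluster E \<omega>' x \<subseteq> open_cluster E \<omega> x"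
proof -
  have "(\<lambda>u v. E u v \<and> \<omega>' u \<and> \<omega>' v)\<^sup>*\<^sup>* \<le> (\<lambda>u v. E u v \<and> \<omega> u \<and> \<omega> v)\<^sup>*\<^sup>*"
    using assms by (intro rtranclp_mono) auto
  then show ?thesis using assms by (auto simp: open_cluster_def)
qed

text \<open>Local finiteness makes the set of vertices reachable from \<open>x\<close> countable,
  even if the graph is not. Cluster events can then be united measurably.\<close>

lemma countable_clusters:
  assumes "\<And>x. finite {y. E x y}"
  shows "countable {C. finite C \<and> x \<in> C \<and> connected_in E C}"
proof (rule countable_subset)
  let ?T = "{(u, v). E u v}\<^sup>* `` {x}"
  have "countable ?T"
  proof (rule countable_rtrancl)
    fix Y :: "'a set" assume "countable Y"
    moreover have "{(u, v). E u v} `` Y = (\<Union>u\<in>Y. {v. E u v})" by auto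
    moreover have "countable (\<Union>u\<in>Y. {v. E u v})"
      using \<open>countable Y\<close> assms by (intro countable_UN) (auto intro: countable_finite)
    ultimately show "countable ({(u, v). E u v} `` Y)" by simp
  qed simp
  then show "countable {C. finite C \<and> C \<subseteq> ?T}" by (rule countable_Collect_finite_subset)
  show "{C. finite C \<and> x \<in> C \<and> connected_in E C} \<subseteq> {C. finite C \<and> C \<subseteq> ?T}"
  proof (intro subsetI CollectI conjI)
    fix C y assume C: "C \<in> {C. finite C \<and> x \<in> C \<and> connected_in E C}" and "y \<in> C"
    then have "(\<lambda>u v. E u v \<and> u \<in> C \<and> v \<in> C)\<^sup>*\<^sup>* x y" by (simp add: connected_in_def)
    then have "E\<^sup>*\<^sup>* x y" by (rule rtranclp_mono[THEN predicate2D, rotated]) auto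
    then show "y \<in> ?T" by (simp add: rtranclp_rtrancl_eq[symmetric])
  qed auto
qed

text \<open>The summands are the probabilities that the open cluster of \<open>x\<close> equals \<open>C\<close>.\<close>

lemma subcritical_cluster_sum:
  assumes E: "symp E" and r: "0 < r" "r \<le> q" "q \<le> 1" and lf: "\<And>x. finite {y. E x y}"
    and fin: "AE \<omega> in site_percolation q. finite (open_cluster E \<omega> x)" and e: "e > 0"
  obtains \<C> where "finite \<C>" "\<And>C. C \<in> \<C> \<Longrightarrow> finite C \<and> x \<in> C \<and> connected_in E C"
    "(\<Sum>C\<in>\<C>. r ^ card C * (1 - r) ^ card (boundary E C)) > r - e"
proof -
  let ?M = "site_percolation r"
  interpret prob_space ?M by (rule prob_space_site_percolation)
  define K where "K = {C. finite C \<and> x \<in> C \<and> connected_in E C}"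
  define ev where "ev C = cylinder C (boundary E C)" for C
  have K: "countable K" unfolding K_def by (rule countable_clusters[OF lf])
  \<comment> \<open>Nonemptiness lets \<open>from_nat_into\<close> enumerate
    \<open>K\<close>.\<close>
  have "{x} \<in> K" by (simp add: K_def connected_in_def)
  then have Kne: "K \<noteq> {}" by blast
  have ev: "ev C \<in> sets ?M" if "C \<in> K" for C
    using that finite_boundary[OF E lf] unfolding ev_def K_def by (intro sets_cylinder) auto
  have prob_ev: "prob (ev C) = r ^ card C * (1 - r) ^ card (boundary E C)" if "C \<in> K" for C
    using that finite_boundary[OF E lf, of C] r unfolding ev_def K_def
    by (intro measure_cylinder boundary_disjoint) auto
  have disj: "ev C \<inter> ev C' = {}" if C: "C \<in> K" "C' \<in> K" "C \<noteq> C'" for C C'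
  proof -
    obtain z where "z \<in> C \<inter> boundary E C' \<union> boundary E C \<inter> C'"
      using distinct_clusters_meet_boundary[OF E, of C C' x] C by (auto simp: K_def)
    then show ?thesis by (auto simp: ev_def cylinder_def)
  qed
  let ?U = "\<Union>n. ev (from_nat_into K n)"
  have evn: "ev (from_nat_into K n) \<in> sets ?M" for n by (intro ev from_nat_into Kne)
  \<comment> \<open>Finiteness is known at \<open>q\<close>, and closing sites shrinks the cluster.
    At \<open>r\<close> the conclusion is phrased through the countable union \<open>?U\<close>, a
    measurable event.\<close>
  have "AE \<omega> in ?M. \<omega> x \<longrightarrow> \<omega> \<in> ?U"
  proof (rule site_percolation_coupling[OF _ r(2) _ r(3) fin])
    show "{\<omega>. \<omega> x \<longrightarrow> \<omega> \<in> ?U} \<in> sets ?M"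
    proof -
      have "{\<omega>. \<omega> x \<longrightarrow> \<omega> \<in> ?U} = cylinder {} {x} \<union> ?U" by (auto simp: cylinder_def)
      then show ?thesis using evn by (auto intro!: sets.Un sets_cylinder sets.countable_UN)
    qed
    fix \<omega> \<omega>' assume "finite (open_cluster E \<omega> x)" "\<And>z. \<omega>' z \<Longrightarrow> \<omega> z"
    then have fC: "finite (open_cluster E \<omega>' x)" using open_cluster_mono finite_subset by metis
    show "\<omega>' x \<longrightarrow> \<omega>' \<in> ?U"
    proof
      assume "\<omega>' x"
      from open_cluster_connected[of E \<omega>' x, OF E this] fC
      have "open_cluster E \<omega>' x \<in> K" "\<omega>' \<in> ev (open_cluster E \<omega>' x)"
        by (simp_all add: K_def ev_def)
      moreover from this obtain n where "from_nat_into K n = open_cluster E \<omega>' x"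
        using from_nat_into_surj[OF K] by blast
      ultimately show "\<omega>' \<in> ?U" by (metis UN_I UNIV_I)
    qed
  qed (use r in auto)
  then have "prob (cylinder {x} {}) \<le> prob ?U"
    using evn by (intro finite_measure_mono_AE) (auto simp: cylinder_def)
  then have rU: "r \<le> prob ?U" using r by (simp add: measure_cylinder)
  let ?A = "\<lambda>n. \<Union>k<n. ev (from_nat_into K k)"
  have "(\<lambda>n. prob (?A n)) \<longlonglongrightarrow> prob (\<Union>n. ?A n)"
    using evn by (intro finite_Lim_measure_incseq) (auto simp: incseq_def intro: less_le_trans)
  moreover have "(\<Union>n. ?A n) = ?U" by auto
  ultimately have "eventually (\<lambda>n. prob (?A n) > r - e) sequentially"
    using rU e by (intro order_tendstoD(1)[where y = "prob ?U"]) auto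
  then obtain n where n: "prob (?A n) > r - e" by (auto simp: eventually_sequentially)
  \<comment> \<open>The enumeration may repeat clusters; taking its image as a set makes the events
    pairwise disjoint.\<close>
  define \<C> where "\<C> = from_nat_into K ` {..<n}"
  have CK: "\<C> \<subseteq> K" unfolding \<C>_def using from_nat_into[OF Kne] by blast
  have "?A n = (\<Union>C\<in>\<C>. ev C)" by (simp add: \<C>_def)
  moreover have "disjoint_family_on ev \<C>"
    unfolding disjoint_family_on_def using disj subsetD[OF CK] by blast
  ultimately have "prob (?A n) = (\<Sum>C\<in>\<C>. prob (ev C))"
    using CK ev by (simp only:) (intro finite_measure_finite_Union, auto simp: \<C>_def)
  also have "\<dots> = (\<Sum>C\<in>\<C>. r ^ card C * (1 - r) ^ card (boundary E C))"
    using CK by (intro sum.cong prob_ev) auto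
  finally have "(\<Sum>C\<in>\<C>. r ^ card C * (1 - r) ^ card (boundary E C)) > r - e" using n by simp
  moreover have "finite \<C>" by (simp add: \<C>_def)
  moreover have "finite C \<and> x \<in> C \<and> connected_in E C" if "C \<in> \<C>" for C
    using subsetD[OF CK that] by (simp add: K_def)
  ultimately show ?thesis by (rule that[rotated 2])
qed

lemma less_critical_parameterE:
  assumes "r < critical_parameter E"
  obtains q where "r < q" "q \<le> 1" "\<And>x. AE \<omega> in site_percolation q. finite (open_cluster E \<omega> x)"
proof -
  let ?Q = "{q. 0 \<le> q \<and> q \<le> 1 \<and> (\<forall>x. AE \<omega> in site_percolation q. finite (open_cluster E \<omega> x))}"
  \<comment> \<open>At parameter 0 all clusters are almost surely empty; this makes the set under
    the supremum nonempty.\<close>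
  have "AE \<omega> in site_percolation 0. finite (open_cluster E \<omega> x)" for x
  proof -
    have "AE b in measure_pmf (bernoulli_pmf 0). \<not> b"
      by (auto simp: AE_measure_pmf_iff set_pmf_iff)
    then have "AE \<omega> in site_percolation 0. \<not> \<omega> x"
      unfolding site_percolation_def by (intro AE_PiM_component prob_space_measure_pmf) auto
    then show ?thesis by eventually_elim (simp add: open_cluster_def)
  qed
  then have "0 \<in> ?Q" by simp
  then have "?Q \<noteq> {}" by blast
  with assms obtain q where "q \<in> ?Q" "r < q"
    unfolding critical_parameter_def by (rule less_cSupE)
  then show ?thesis using that by blast
qed

theorem corollary5p4:
  fixes E :: "'v \<Rightarrow> 'v \<Rightarrow> bool"
    and p :: "'v \<Rightarrow> 'v \<Rightarrow> real"
    and off :: "'h::finite"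
  assumes "simple_graph E"
    and "nearest_neighbour_walk E p"
    and "selfadjoint_on_ell2 UNIV (transition_op UNIV p)"
    and "CARD('h) \<ge> 2"
    and "1 / real CARD('h) < critical_parameter E"
  shows "\<exists>B :: (('v \<Rightarrow> 'h) \<times> 'v \<Rightarrow> complex) set.
           complete_orthonormal_system (lamp_states off) B \<and>
           (\<forall>f\<in>B. finitely_supported f \<and>
                   eigenfunction_on_ell2 (lamp_states off) (lamplighter_op E p off) f)"
proof -
  let ?r = "1 / real CARD('h)"
  have E: "symp E" "irreflp E" using assms(1) by (auto simp: simple_graph_def)
  have p: "\<And>x y. \<not> E x y \<Longrightarrow> p x y = 0" using assms(2) by (auto simp: nearest_neighbour_walk_def)
  have p_sym: "\<And>x y. p x y = p y x" by (rule transition_op_selfadjoint_imp_symmetric[OF assms(3)])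
  have r: "0 < ?r" using assms(4) by simp
  obtain q where q: "?r < q" "q \<le> 1" "\<And>x. AE \<omega> in site_percolation q. finite (open_cluster E \<omega> x)"
    using less_critical_parameterE[OF assms(5)] by blast
  have lf: "finite {y. E x y}" for x
    by (rule locally_finite_if_finite_clusters[OF less_trans[OF r q(1)] q(2,3)])
  \<comment> \<open>Normalising \<open>\<zeta>\<close> to \<open>off\<close> on
    \<open>C \<union> D\<close> lists each choice of frozen lamps once; otherwise one sector would
    carry several indices and orthogonality for \<open>i \<noteq> j\<close> would fail.\<close>
  define I :: "(('v set \<times> 'v set \<times> 'v set) \<times> ('v \<Rightarrow> 'h)) set"
    where "I = {((W, C, D), \<zeta>) | W C D \<zeta>. percolation_pattern E (W, C, D) \<and> \<zeta> \<in> configs off \<and> (\<forall>z\<in>C \<union> D. \<zeta> z = off)}"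
  define X :: "('v set \<times> 'v set \<times> 'v set) \<times> ('v \<Rightarrow> 'h) \<Rightarrow> (('v \<Rightarrow> 'h) \<times> 'v) set"
    where "X = (\<lambda>((W, C, D), \<zeta>). agree (C \<union> D) \<zeta> \<times> W)"
  define U :: "('v set \<times> 'v set \<times> 'v set) \<times> ('v \<Rightarrow> 'h) \<Rightarrow> (('v \<Rightarrow> 'h) \<times> 'v \<Rightarrow> complex) set"
    where "U = (\<lambda>((W, C, D), \<zeta>). sector W C D \<zeta>)"
  have I_cases: thesis
    if "i \<in> I" "\<And>W C D \<zeta>. i = ((W, C, D), \<zeta>) \<Longrightarrow> percolation_pattern E (W, C, D) \<Longrightarrow> \<zeta> \<in> configs off \<Longrightarrow>
      (\<And>z. z \<in> C \<union> D \<Longrightarrow> \<zeta> z = off) \<Longrightarrow> finite W \<Longrightarrow> finite (C \<union> D) \<Longrightarrow> C \<inter> D = {} \<Longrightarrow>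
      X i = agree (C \<union> D) \<zeta> \<times> W \<Longrightarrow> U i = sector W C D \<zeta> \<Longrightarrow> thesis" for i thesis
  proof -
    obtain W C D \<zeta> where i: "i = ((W, C, D), \<zeta>)" "percolation_pattern E (W, C, D)" "\<zeta> \<in> configs off"
      "\<forall>z\<in>C \<union> D. \<zeta> z = off" using \<open>i \<in> I\<close> unfolding I_def by blast
    show thesis
      by (rule that(2)[OF i(1-3) bspec[OF i(4)] percolation_pattern_finite[OF E(1) lf i(2)]])
        (simp_all add: i X_def U_def)
  qed
  show ?thesis
  proof (rule eigenbasis_of_orthogonal_family[of I X "lamp_states off" U])
    show "finite (X i)" if "i \<in> I" for i
      using that by (rule I_cases) (simp add: finite_agree)
    show "X i \<subseteq> lamp_states off" if "i \<in> I" for i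
      using that by (rule I_cases) (simp add: sector_support_lamp_states)
    show "fun_subspace (U i)" if "i \<in> I" for i
      using that by (rule I_cases) (simp add: fun_subspace_sector)
    show "U i \<subseteq> {f. \<forall>s. s \<notin> X i \<longrightarrow> f s = 0}" if "i \<in> I" for i
      using that by (rule I_cases) (simp only: sector_support)
    show "lamplighter_op E p off f \<in> U i" if "i \<in> I" "f \<in> U i" for i f
      using that(1)
    proof (rule I_cases)
      fix W C D \<zeta> assume *: "percolation_pattern E (W, C, D)" "\<zeta> \<in> configs off" "U i = sector W C D \<zeta>"
      show ?thesis
        using lamplighter_op_sector_invariant[where E = E and p = p, OF lf E p *(2,1)] that(2) unfolding *(3) by blast
    qed
    show "lamplighter_op E p off (\<lambda>s. \<Sum>b\<in>B. c b * b s) = (\<lambda>s. \<Sum>b\<in>B. c b * lamplighter_op E p off b s)" for B c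
      by (rule lamplighter_op_sum[OF lf E(2)])
    show "ell2_inner (lamp_states off) (lamplighter_op E p off f) g
        = ell2_inner (lamp_states off) f (lamplighter_op E p off g)"
      if "i \<in> I" "f \<in> U i" "g \<in> U i" for i f g
      using that(1)
    proof (rule I_cases)
      fix W C D \<zeta> assume *: "percolation_pattern E (W, C, D)" "\<zeta> \<in> configs off" "U i = sector W C D \<zeta>"
      show ?thesis
        using lamplighter_op_sector_symmetric[where E = E and p = p, OF lf E p p_sym *(2,1)] that(2,3) unfolding *(3) by blast
    qed
    show "ell2_inner (lamp_states off) f g = 0"
      if ij: "i \<in> I" "j \<in> I" "i \<noteq> j" and f: "f \<in> U i" and g: "g \<in> U j" for i j f g
    proof -
      have disjoint: ?thesis if "\<And>s. f s = 0 \<or> g s = 0"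
        unfolding ell2_inner_restrict[of "{}" "lamp_states off" f g, OF empty_subsetI that]
        by (simp add: ell2_inner_def)
      show ?thesis
        using ij(1)
      proof (rule I_cases)
        fix W C D \<zeta>
        assume i: "i = ((W, C, D), \<zeta>)" "percolation_pattern E (W, C, D)" "\<zeta> \<in> configs off"
          "\<And>z. z \<in> C \<union> D \<Longrightarrow> \<zeta> z = off" "finite W" "finite (C \<union> D)" "U i = sector W C D \<zeta>"
        show ?thesis
          using ij(2)
        proof (rule I_cases)
          fix W' C' D' \<zeta>'
          assume j: "j = ((W', C', D'), \<zeta>')" "percolation_pattern E (W', C', D')"
            "\<And>z. z \<in> C' \<union> D' \<Longrightarrow> \<zeta>' z = off" "U j = sector W' C' D' \<zeta>'"
          note f' = f[unfolded i(7)] and g' = g[unfolded j(4)]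
          consider "W \<inter> W' = {}" | "C \<inter> D' \<union> D \<inter> C' \<noteq> {}" | "(W, C, D) = (W', C', D')" "\<zeta> \<noteq> \<zeta>'"
            using percolation_pattern_distinct[OF E(1) i(2) j(2)] ij(3) i(1) j(1) by blast
          then show ?thesis
          proof cases
            case 2
            then obtain z where "z \<in> C \<inter> D' \<union> D \<inter> C'" by blast
            then show ?thesis by (rule sector_orthogonal[OF i(6,5,3) f' g'])
          next
            case 1
            have "f s = 0 \<or> g s = 0" for s
            proof -
              have "snd s \<notin> W \<or> snd s \<notin> W'" using 1 by blast
              then show ?thesis
                using sectorD(1)[OF f', of "snd s" "fst s"] sectorD(1)[OF g', of "snd s" "fst s"] by auto
            qed
            then show ?thesis by (rule disjoint)
          next
            case 3
            then obtain z where z: "\<zeta> z \<noteq> \<zeta>' z" by (auto simp: fun_eq_iff)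
            \<comment> \<open>Both configurations are \<open>off\<close> on
              \<open>C \<union> D\<close>, so they differ at a frozen lamp and the supports are
              disjoint.\<close>
            then have "z \<notin> C \<union> D" using i(4)[of z] j(3)[of z] 3(1) by auto
            then have "agree (C \<union> D) \<zeta> \<inter> agree (C' \<union> D') \<zeta>' = {}" using z 3(1) by (auto simp: agree_def)
            then have "fst s \<notin> agree (C \<union> D) \<zeta> \<or> fst s \<notin> agree (C' \<union> D') \<zeta>'" for s :: "('v \<Rightarrow> 'h) \<times> 'v"
              by blast
            then have "f s = 0 \<or> g s = 0" for s
              using sectorD(2)[OF f', of "fst s" "snd s"] sectorD(2)[OF g', of "fst s" "snd s"]
              by (metis prod.collapse)
            then show ?thesis by (rule disjoint)
          qed
        qed
      qed
    qed
    show "\<exists>J k. finite J \<and> J \<subseteq> I \<and>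
        (\<forall>i\<in>J. k i \<in> U i \<and> (\<forall>f\<in>U i. ell2_inner (lamp_states off) f (k i) = f s)) \<and> (\<Sum>i\<in>J. Re (k i s)) > 1 - e"
      if s: "s \<in> lamp_states off" and e: "e > 0" for s and e :: real
    proof -
      obtain \<xi> x where sx: "s = (\<xi>, x)" by (cases s)
      have \<xi>: "\<xi> \<in> configs off" using s by (simp add: sx lamp_states_def)
      obtain \<C> where \<C>: "finite \<C>" "\<And>C. C \<in> \<C> \<Longrightarrow> finite C \<and> x \<in> C \<and> connected_in E C"
        "(\<Sum>C\<in>\<C>. ?r ^ card C * (1 - ?r) ^ card (boundary E C)) > ?r - e"
        using subcritical_cluster_sum[OF E(1) r less_imp_le[OF q(1)] q(2) lf q(3) e] by blast
      \<comment> \<open>Resetting \<open>\<xi>\<close> on \<open>C \<union> D\<close> gives the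
        normalised name of the sector whose kernel sits at \<open>s\<close>.\<close>
      define index where "index W C D = ((W, C, D), \<lambda>z. if z \<in> C \<union> D then off else \<xi> z)" for W C D :: "'v set"
      define k where "k = (\<lambda>((W :: 'v set, C, D), \<zeta> :: 'v \<Rightarrow> 'h). sector_kernel C D s)"
      define cl where "cl C = index C C (boundary E C)" for C
      define J where "J = insert (index {x} {} {x}) (cl ` \<C>)"
      have index: "index W C D \<in> I" "k (index W C D) \<in> U (index W C D)"
        "\<forall>f\<in>U (index W C D). ell2_inner (lamp_states off) f (k (index W C D)) = f s"
        "Re (k (index W C D) s) = ?r ^ card C * (1 - ?r) ^ card D"
        if P: "percolation_pattern E (W, C, D)" and x: "x \<in> W" for W C D
      proof -
        let ?\<zeta> = "\<lambda>z. if z \<in> C \<union> D then off else \<xi> z"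
        note fins = percolation_pattern_finite[OF E(1) lf P]
        have ag: "agree (C \<union> D) ?\<zeta> = agree (C \<union> D) \<xi>" by (auto simp: agree_def)
        have "?\<zeta> \<in> agree (C \<union> D) \<xi>" by (auto simp: agree_def)
        then have "?\<zeta> \<in> configs off" using agree_configs[OF fins(2) \<xi>] by blast
        then show "index W C D \<in> I" using P unfolding index_def I_def by auto
        have U: "U (index W C D) = sector W C D \<xi>"
          using sector_cong[OF ag] by (simp add: U_def index_def)
        have k: "k (index W C D) = sector_kernel C D (\<xi>, x)" by (simp add: k_def index_def sx)
        show "k (index W C D) \<in> U (index W C D)"
          unfolding U k by (rule sector_kernel_in_sector[OF fins(2,3) x])
        show "\<forall>f\<in>U (index W C D). ell2_inner (lamp_states off) f (k (index W C D)) = f s"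
          unfolding U k sx using sector_kernel_reproducing[OF fins(2,1,3) \<xi> _ x] by blast
        show "Re (k (index W C D) s) = ?r ^ card C * (1 - ?r) ^ card D"
          unfolding k sx by (rule sector_kernel_diag[OF fins(2,3)])
      qed
      have closed: "percolation_pattern E ({x}, {}, {x})" by (simp add: percolation_pattern_def)
      have cluster: "percolation_pattern E (C, C, boundary E C)" "x \<in> C" if "C \<in> \<C>" for C
        using \<C>(2)[OF that] by (auto simp: percolation_pattern_def)
      note closed_index = index[OF closed singletonI]
      note cl_index = index[OF cluster, folded cl_def]
      have inj: "inj_on cl \<C>" by (auto simp: inj_on_def cl_def index_def)
      have new: "index {x} {} {x} \<notin> cl ` \<C>" by (auto simp: cl_def index_def)
      have "(\<Sum>i\<in>J. Re (k i s)) = Re (k (index {x} {} {x}) s) + (\<Sum>C\<in>\<C>. Re (k (cl C) s))"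
        unfolding J_def using \<C>(1) new inj by (simp add: sum.reindex)
      \<comment> \<open>The closed walker contributes \<open>1 - ?r\<close>, with no open lamp and
        one closed lamp; the clusters supply more than \<open>?r - e\<close>.\<close>
      also have "\<dots> = (1 - ?r) + (\<Sum>C\<in>\<C>. ?r ^ card C * (1 - ?r) ^ card (boundary E C))"
        using cl_index(4) by (simp add: closed_index(4))
      finally have "(\<Sum>i\<in>J. Re (k i s)) > 1 - e" using \<C>(3) by simp
      moreover have "finite J" "J \<subseteq> I" using \<C>(1) cl_index(1) closed_index(1) by (auto simp: J_def)
      moreover have "\<forall>i\<in>J. k i \<in> U i \<and> (\<forall>f\<in>U i. ell2_inner (lamp_states off) f (k i) = f s)"
        unfolding J_def using cl_index(2,3) closed_index(2,3) by blast
      ultimately show ?thesis by blast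
    qed
  qed
qed

end
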